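(* Let $n\le m$ be positive integers, let $k=\mathrm{lcm}(n,m)$, $a=k/n$, $b=k/m$, and let $\lambda=(a^n)$ and $\mu=(b^m)$ be the two rectangular partitions of $k$ (with $n$ parts equal to $a$, respectively $m$ parts equal to $b$). Let $\nu$ be the partition of strip type derived from $(\lambda,\mu)$. Then the maximal lexicographic spectrum for states in $\mathcal{C}(\frac1n I_n,\frac1m I_m)$ is $\nu/k$; that is, $\nu/k$ is the maximum, with respect to lexicographic order, of the set $\mathcal{S}(\frac1n I_n,\frac1m I_m)$.
   Context: Density operators (states) on a finite-dimensional complex Hilbert space $\mathcal{H}$ are positive semidefinite operators of trace $1$; $\mathcal{D}(\mathcal{H})$ is the set of them. $\mathrm{Spec}\,\rho$ is the vector of eigenvalues of $\rho$ (with multiplicity) in decreasing order. For $\rho_A\in\mathcal{D}(\mathcal{H}_A)$, $\rho_B\in\mathcal{D}(\mathcal{H}_B)$, $\mathcal{C}(\rho_A,\rho_B)=\{\rho\in\mathcal{D}(\mathcal{H}_A\otimes\mathcal{H}_B) : \mathrm{tr}_B(\rho)=\rho_A,\ \mathrm{tr}_A(\rho)=\rho_B\}$, where $\mathrm{tr}_A,\mathrm{tr}_B$ are the partial traces, and $\mathcal{S}(\rho_A,\rho_B)=\{\mathrm{Spec}\,\rho : \rho\in\mathcal{C}(\rho_A,\rho_B)\}$. $I_n$ is the $n\times n$ identity; here $\mathcal{H}_A=\mathbb{C}^n$, $\mathcal{H}_B=\mathbb{C}^m$. Lexicographic order: $x$ is less than $y$ if for some index $i$, $x_j=y_j$ for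 $j<i$ and $x_i<y_i$; $x\le y$ means less than or equal. Partitions and spectra are identified with those obtained by appending zeros; $\nu/k$ is the partition $\nu$ with all parts divided by $k$. For partitions $\alpha,\beta$: $|\alpha|$ is the sum of the parts; $\alpha\cap\beta=(\min\{\alpha_1,\beta_1\},\min\{\alpha_2,\beta_2\},\dots)$; $\beta\subset\alpha$ means $\beta_i\le\alpha_i$ for all $i$ with strict inequality for some $i$. $c^{\gamma}_{\alpha,\beta}$ denotes the Littlewood–Richardson coefficient. Let $\lambda,\mu$ be partitions of the same integer. Given two strictly decreasing sequences of partitions $\lambda=\lambda(1)\supset\cdots\supset\lambda(r)\supset\lambda(r+1)=\emptyset$ and $\mu=\mu(1)\supset\cdots\supset\mu(r)\supset\mu(r+1)=\emptyset$ such that $c^{\lambda(i)}_{\lambda(i)\cap\mu(i),\,\lambda(i+1)}\ne 0$ and $c^{\mu(i)}_{\lambda(i)\cap\mu(i),\,\mu(i+1)}\neq 0$ for all $1\le i\le r$, set $\nu_i=|\lambda(i)\cap\mu(i)|$ for $1\le i\le r$. Then $\nu=(\nu_1,\dots,\nu_r)$ is a partition, and any $\nu$ obtained in this way is called a partition of strip type derived from $(\lambda,\mu)$. When $\lambda$ and $\mu$ are both rectangular (all parts equal), there is exactly one partition of strip type derived from $(\lambda,\mu)$. *)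

theory Defs
  imports
    "Jordan_Normal_Form.Schur_Decomposition"
    "HOL-Library.Fun_Lexorder"
    "HOL-Library.FuncSet"
    "HOL-Library.More_List"
    "HOL-Library.Multiset"
begin

section \<open>Partitions, Littlewood-Richardson coefficients, strip type\<close>

text \<open>Partitions are weakly decreasing functions \<open>nat \<Rightarrow> nat\<close> of finite support, so that appending
  zeros changes nothing; parts are indexed from 0. The intersection of partitions is the pointwise
  \<^const>\<open>inf\<close>, and strict containment is \<open><\<close> on functions.\<close>

definition is_partition :: "(nat \<Rightarrow> nat) \<Rightarrow> bool" where
  "is_partition \<alpha> \<longleftrightarrow> antimono \<alpha> \<and> finite {i. \<alpha> i \<noteq> 0}"

definition psize :: "(nat \<Rightarrow> nat) \<Rightarrow> nat" where
  "psize \<alpha> = (\<Sum>i | \<alpha> i \<noteq> 0. \<alpha> i)"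

definition rect_partition :: "nat \<Rightarrow> nat \<Rightarrow> nat \<Rightarrow> nat" where
  "rect_partition a n = (\<lambda>i. if i < n then a else 0)"

text \<open>A box is a pair (row, column).\<close>

definition skew_diagram :: "(nat \<Rightarrow> nat) \<Rightarrow> (nat \<Rightarrow> nat) \<Rightarrow> (nat \<times> nat) set" where
  "skew_diagram \<gamma> \<alpha> = {(i, j). \<alpha> i \<le> j \<and> j < \<gamma> i}"

text \<open>Boxes that come no later than \<open>(i, j)\<close> when rows are read from right to left, starting with
  the top row.\<close>

definition read_upto :: "nat \<times> nat \<Rightarrow> (nat \<times> nat) set" where
  "read_upto = (\<lambda>(i, j). {(i', j'). i' < i \<or> i' = i \<and> j \<le> j'})"

text \<open>Tableaux of shape \<open>\<gamma>/\<alpha>\<close> and content \<open>\<beta>\<close>: semistandard fillings whose reading word is a lattice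
  word. Entries start at 0, so entry \<open>v\<close> occurs \<open>\<beta> v\<close> times. Extensionality makes the filling
  unique outside of the diagram, so that tableaux can be counted.\<close>

definition LR_tableaux ::
  "(nat \<Rightarrow> nat) \<Rightarrow> (nat \<Rightarrow> nat) \<Rightarrow> (nat \<Rightarrow> nat) \<Rightarrow> (nat \<times> nat \<Rightarrow> nat) set" where
  "LR_tableaux \<gamma> \<alpha> \<beta> = {T \<in> extensional (skew_diagram \<gamma> \<alpha>).
     (\<forall>i j j'. (i, j) \<in> skew_diagram \<gamma> \<alpha> \<longrightarrow> (i, j') \<in> skew_diagram \<gamma> \<alpha> \<longrightarrow> j < j' \<longrightarrow>
        T (i, j) \<le> T (i, j')) \<and>
     (\<forall>i i' j. (i, j) \<in> skew_diagram \<gamma> \<alpha> \<longrightarrow> (i', j) \<in> skew_diagram \<gamma> \<alpha> \<longrightarrow> i < i' \<longrightarrow>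
        T (i, j) < T (i', j)) \<and>
     (\<forall>v. card {p \<in> skew_diagram \<gamma> \<alpha>. T p = v} = \<beta> v) \<and>
     (\<forall>q \<in> skew_diagram \<gamma> \<alpha>. \<forall>v.
        card {p \<in> skew_diagram \<gamma> \<alpha> \<inter> read_upto q. T p = Suc v}
          \<le> card {p \<in> skew_diagram \<gamma> \<alpha> \<inter> read_upto q. T p = v})}"

text \<open>\<open>LR_coeff \<gamma> \<alpha> \<beta>\<close> is \<open>c\<close> with upper index \<open>\<gamma>\<close> and lower indices \<open>\<alpha>, \<beta>\<close>, by the
  Littlewood-Richardson rule.\<close>

definition LR_coeff :: "(nat \<Rightarrow> nat) \<Rightarrow> (nat \<Rightarrow> nat) \<Rightarrow> (nat \<Rightarrow> nat) \<Rightarrow> nat" where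
  "LR_coeff \<gamma> \<alpha> \<beta> = (if \<alpha> \<le> \<gamma> then card (LR_tableaux \<gamma> \<alpha> \<beta>) else 0)"

text \<open>The two chains are indexed from 0: \<open>L i\<close> is the usual \<open>\<lambda>(i+1)\<close>, hence \<open>L r = \<emptyset>\<close>.\<close>

definition strip_type :: "(nat \<Rightarrow> nat) \<Rightarrow> (nat \<Rightarrow> nat) \<Rightarrow> (nat \<Rightarrow> nat) \<Rightarrow> bool" where
  "strip_type \<alpha> \<beta> \<nu> \<longleftrightarrow> is_partition \<alpha> \<and> is_partition \<beta> \<and> psize \<alpha> = psize \<beta> \<and>
     (\<exists>(r::nat) (L :: nat \<Rightarrow> nat \<Rightarrow> nat) (M :: nat \<Rightarrow> nat \<Rightarrow> nat).
        (\<forall>i\<le>r. is_partition (L i) \<and> is_partition (M i)) \<and>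
        L 0 = \<alpha> \<and> M 0 = \<beta> \<and> L r = (\<lambda>_. 0) \<and> M r = (\<lambda>_. 0) \<and>
        (\<forall>i<r. L (Suc i) < L i \<and> M (Suc i) < M i \<and>
           LR_coeff (L i) (inf (L i) (M i)) (L (Suc i)) \<noteq> 0 \<and>
           LR_coeff (M i) (inf (L i) (M i)) (M (Suc i)) \<noteq> 0) \<and>
        \<nu> = (\<lambda>i. if i < r then psize (inf (L i) (M i)) else 0))"


section \<open>States, partial traces, spectra\<close>

definition positive_semidefinite :: "complex mat \<Rightarrow> bool" where
  "positive_semidefinite A \<longleftrightarrow> square_mat A \<and> mat_adjoint A = A \<and>
     (\<forall>v \<in> carrier_vec (dim_row A). 0 \<le> (A *\<^sub>v v) \<bullet>c v)"

definition mat_trace :: "complex mat \<Rightarrow> complex" where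
  "mat_trace A = (\<Sum>i<dim_row A. A $$ (i, i))"

definition density_operators :: "nat \<Rightarrow> complex mat set" where
  "density_operators d = {\<rho> \<in> carrier_mat d d. positive_semidefinite \<rho> \<and> mat_trace \<rho> = 1}"

text \<open>The tensor product of the spaces of dimension \<open>n\<close> and \<open>m\<close> is the space of dimension \<open>n * m\<close>,
  the basis vector \<open>e\<^sub>i \<otimes> f\<^sub>j\<close> having index \<open>i * m + j\<close>.\<close>

definition ptrace_B :: "nat \<Rightarrow> nat \<Rightarrow> complex mat \<Rightarrow> complex mat" where
  "ptrace_B n m \<rho> = mat n n (\<lambda>(i, i'). \<Sum>j<m. \<rho> $$ (i * m + j, i' * m + j))"

definition ptrace_A :: "nat \<Rightarrow> nat \<Rightarrow> complex mat \<Rightarrow> complex mat" where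
  "ptrace_A n m \<rho> = mat m m (\<lambda>(j, j'). \<Sum>i<n. \<rho> $$ (i * m + j, i * m + j'))"

definition couplings :: "complex mat \<Rightarrow> complex mat \<Rightarrow> complex mat set" where
  "couplings \<rho>A \<rho>B = {\<rho> \<in> density_operators (dim_row \<rho>A * dim_row \<rho>B).
     ptrace_B (dim_row \<rho>A) (dim_row \<rho>B) \<rho> = \<rho>A \<and> ptrace_A (dim_row \<rho>A) (dim_row \<rho>B) \<rho> = \<rho>B}"

text \<open>The decreasing sequence of eigenvalues with multiplicity, continued by zeros. Only used for
  Hermitian matrices, where \<^const>\<open>Re\<close> loses nothing.\<close>

definition Spec :: "complex mat \<Rightarrow> nat \<Rightarrow> real" where
  "Spec A = nth_default 0 (rev (sorted_list_of_multiset (image_mset Re (proots (char_poly A)))))"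

definition coupling_spectra :: "complex mat \<Rightarrow> complex mat \<Rightarrow> (nat \<Rightarrow> real) set" where
  "coupling_spectra \<rho>A \<rho>B = Spec ` couplings \<rho>A \<rho>B"

definition lex_le :: "(nat \<Rightarrow> real) \<Rightarrow> (nat \<Rightarrow> real) \<Rightarrow> bool" where
  "lex_le x y \<longleftrightarrow> less_fun x y \<or> x = y"

definition is_lex_max :: "(nat \<Rightarrow> real) \<Rightarrow> (nat \<Rightarrow> real) set \<Rightarrow> bool" where
  "is_lex_max x X \<longleftrightarrow> x \<in> X \<and> (\<forall>y\<in>X. lex_le y x)"

definition max_mixed :: "nat \<Rightarrow> complex mat" where
  "max_mixed d = (1 / of_nat d) \<cdot>\<^sub>m 1\<^sub>m d"

end

theory Submission
  imports Defs "HOL-Combinatorics.List_Permutation"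
begin

text \<open>For rectangles, the chains of the strip type run through the subtractive Euclidean algorithm:
  \<open>\<nu>/k\<close> lists the areas, relative to \<open>n * m\<close>, of the squares obtained by greedily cutting off the
  largest possible square from an \<open>n \<times> m\<close> rectangle. Placing on the diagonal of each square a
  maximally entangled vector, weighted by the relative area of the square, gives a coupling with
  this spectrum.

  For maximality, write a coupling as \<open>\<Sum>\<^sub>t y\<^sub>t y\<^sub>t\<^sup>*\<close> with the eigenvalues \<open>\<bar>y\<^sub>t\<bar>\<^sup>2\<close>, and read \<open>y\<^sub>t\<close> as an
  \<open>n \<times> m\<close> matrix \<open>Y\<^sub>t\<close>; the marginals become \<open>\<Sum>\<^sub>t Y\<^sub>t Y\<^sub>t\<^sup>*\<close> and the transpose of \<open>\<Sum>\<^sub>t Y\<^sub>t\<^sup>* Y\<^sub>t\<close>. If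
  these two sums are \<open>u y P\<close> and \<open>u x Q\<close> for projections \<open>P\<close>, \<open>Q\<close> of ranks \<open>x\<close>, \<open>y\<close>, the
  Cauchy-Schwarz inequality bounds each eigenvalue by \<open>u (min x y)\<^sup>2\<close>. In the case of equality, removing
  \<open>Y\<^sub>t\<close> leaves a family of the same kind, with the rank of the larger projection decreased by the
  rank of the smaller one. This is again the Euclidean algorithm.\<close>

section \<open>Strip type of two rectangles\<close>

text \<open>Strict columns force entries at least \<open>i\<close> in row \<open>i\<close>.
  Conversely, the rightmost box of a row is the first of that row to be read, so by the lattice
  condition an entry \<open>Suc v\<close> there needs a \<open>v\<close> in a higher row, where
  induction bounds it; weakly increasing rows carry the bound to the left.\<close>

lemma LR_tableaux_rectangle_entry:
  assumes D: "skew_diagram \<gamma> \<alpha> = {r..<r + h} \<times> {c..<c + w}"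
    and T: "T \<in> LR_tableaux \<gamma> \<alpha> \<beta>"
    and box: "i < h" "j < w"
  shows "T (r + i, c + j) = i"
proof (rule antisym)
  have row: "T (x, y) \<le> T (x, y')"
    if "x \<in> {r..<r + h}" "y \<in> {c..<c + w}" "y' \<in> {c..<c + w}" "y \<le> y'" for x y y'
    using T that unfolding LR_tableaux_def D by (cases "y = y'") auto
  have col: "T (x, y) < T (x', y)"
    if "x \<in> {r..<r + h}" "x' \<in> {r..<r + h}" "y \<in> {c..<c + w}" "x < x'" for x x' y
    using T that unfolding LR_tableaux_def D by auto
  have lattice: "card {p \<in> {r..<r + h} \<times> {c..<c + w} \<inter> read_upto q. T p = Suc v}
      \<le> card {p \<in> {r..<r + h} \<times> {c..<c + w} \<inter> read_upto q. T p = v}"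
    if "q \<in> {r..<r + h} \<times> {c..<c + w}" for q v
    using T that unfolding LR_tableaux_def D by blast
  show "i \<le> T (r + i, c + j)"
    using box(1)
  proof (induction i)
    case (Suc i)
    have "T (r + i, c + j) < T (r + Suc i, c + j)"
      using Suc.prems box by (intro col) auto
    with Suc show ?case by simp
  qed simp
  show "T (r + i, c + j) \<le> i"
    using box
  proof (induction i arbitrary: j rule: less_induct)
    case (less i)
    let ?q = "(r + i, c + (w - 1))"
    have "T ?q \<le> i"
    proof (cases "T ?q")
      case (Suc v)
      let ?B = "\<lambda>v. {p \<in> {r..<r + h} \<times> {c..<c + w} \<inter> read_upto ?q. T p = v}"
      have "?q \<in> ?B (Suc v)"
        using less.prems Suc by (auto simp: read_upto_def)
      moreover have "finite (?B (Suc v))" by simp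
      ultimately have "card (?B (Suc v)) > 0" using card_gt_0_iff by blast
      also have "\<dots> \<le> card (?B v)"
        using less.prems by (intro lattice) auto
      finally have "?B v \<noteq> {}" using card_gt_0_iff by blast
      then obtain x y where xy: "(x, y) \<in> {r..<r + h} \<times> {c..<c + w}" "(x, y) \<in> read_upto ?q"
        "T (x, y) = v" by auto
      have "x < r + i"
      proof (rule ccontr)
        assume "\<not> x < r + i"
        with xy have "(x, y) = ?q" by (auto simp: read_upto_def)
        with xy(3) Suc show False by simp
      qed
      then have "T (r + (x - r), c + (y - c)) \<le> x - r"
        using xy(1) less.prems by (intro less.IH) auto
      with xy \<open>x < r + i\<close> Suc show ?thesis by auto
    qed simp
    moreover have "T (r + i, c + j) \<le> T ?q"
      using less.prems by (intro row) auto
    ultimately show ?case by simp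
  qed
qed

lemma LR_tableaux_rectangle_content:
  assumes D: "skew_diagram \<gamma> \<alpha> = {r..<r + h} \<times> {c..<c + w}"
    and T: "T \<in> LR_tableaux \<gamma> \<alpha> \<beta>"
  shows "\<beta> = rect_partition w h"
proof
  fix v
  have "{p \<in> skew_diagram \<gamma> \<alpha>. T p = v} = (if v < h then {r + v} \<times> {c..<c + w} else {})"
  proof -
    have "T (x, y) = x - r" if "x \<in> {r..<r + h}" "y \<in> {c..<c + w}" for x y
      using LR_tableaux_rectangle_entry[OF D T, of "x - r" "y - c"] that by auto
    then show ?thesis unfolding D by (auto split: if_splits)
  qed
  moreover have "\<beta> v = card {p \<in> skew_diagram \<gamma> \<alpha>. T p = v}"
    using T unfolding LR_tableaux_def by auto
  ultimately show "\<beta> v = rect_partition w h v"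
    by (auto simp: rect_partition_def card_cartesian_product)
qed

text \<open>On a rectangular skew shape, nonvanishing of the coefficient determines the content.
  This makes each step of the chains deterministic.\<close>

lemma LR_coeff_rectangle:
  assumes "LR_coeff \<gamma> \<alpha> \<beta> \<noteq> 0" and "skew_diagram \<gamma> \<alpha> = {r..<r + h} \<times> {c..<c + w}"
  shows "\<beta> = rect_partition w h"
proof -
  from assms(1) have "LR_tableaux \<gamma> \<alpha> \<beta> \<noteq> {}"
    unfolding LR_coeff_def by (auto split: if_splits)
  with LR_tableaux_rectangle_content[OF assms(2)] show ?thesis by blast
qed

section \<open>Pairs of rectangles and the subtractive Euclidean algorithm\<close>

lemma inf_rect_partition:
  "inf (rect_partition a n) (rect_partition b m) = rect_partition (min a b) (min n m)"
  by (auto simp: rect_partition_def fun_eq_iff inf_nat_def min_def)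

lemma psize_rect_partition: "psize (rect_partition a n) = a * n"
proof -
  have "{i. rect_partition a n i \<noteq> 0} = (if a = 0 then {} else {..<n})"
    by (auto simp: rect_partition_def)
  then show ?thesis by (simp add: psize_def rect_partition_def)
qed

lemma LR_coeff_rectangle_columns:
  assumes "LR_coeff (rect_partition a n) (rect_partition b n) \<beta> \<noteq> 0" "b \<le> a"
  shows "\<beta> = rect_partition (a - b) n"
  by (rule LR_coeff_rectangle[OF assms(1), of 0 _ b])
    (use assms(2) in \<open>auto simp: skew_diagram_def rect_partition_def split: if_splits\<close>)

lemma LR_coeff_rectangle_rows:
  assumes "LR_coeff (rect_partition a n) (rect_partition a m) \<beta> \<noteq> 0" "m \<le> n"
  shows "\<beta> = rect_partition a (n - m)"
  by (rule LR_coeff_rectangle[OF assms(1), of m _ 0])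
    (use assms(2) in \<open>auto simp: skew_diagram_def rect_partition_def split: if_splits\<close>)

text \<open>The sides of the rectangle that remains after cutting off \<open>t\<close> squares. A
  pair with a zero entry is a fixed point, so all later squares have side 0.\<close>

primrec sides :: "nat \<times> nat \<Rightarrow> nat \<Rightarrow> nat \<times> nat" where
  "sides s 0 = s"
| "sides s (Suc t) = (case sides s t of (p, q) \<Rightarrow> if p \<le> q then (p, q - p) else (p - q, q))"

definition square_side :: "nat \<Rightarrow> nat \<Rightarrow> nat \<Rightarrow> nat" where
  "square_side p q t = (case sides (p, q) t of (x, y) \<Rightarrow> min x y)"

text \<open>The strip type yields the algorithm on the reduced pair \<open>(p, q)\<close>, whereas
  the tiling runs it on \<open>(g * p, g * q)\<close>; homogeneity links the two.\<close>

lemma sides_mult: "sides (g * p, g * q) t = map_prod ((*) g) ((*) g) (sides (p, q) t)"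
  by (induction t) (auto split: prod.split simp: diff_mult_distrib2)

lemma square_side_mult: "square_side (g * p) (g * q) t = g * square_side p q t"
  by (auto simp: square_side_def sides_mult split: prod.split simp: nat_mult_min_right)

lemma sides_antimono:
  assumes "s \<le> t"
  shows "fst (sides pq t) \<le> fst (sides pq s)" "snd (sides pq t) \<le> snd (sides pq s)"
proof -
  have "fst (sides pq t) \<le> fst (sides pq s) \<and> snd (sides pq t) \<le> snd (sides pq s)"
    using assms by (induction t rule: dec_induct) (auto split: prod.split)
  then show "fst (sides pq t) \<le> fst (sides pq s)" "snd (sides pq t) \<le> snd (sides pq s)"
    by auto
qed

lemma square_side_antimono: "antimono (square_side p q)"
proof (rule antimonoI)
  fix s t :: nat
  assume "s \<le> t"
  from sides_antimono[OF this, of "(p, q)"] show "square_side p q t \<le> square_side p q s"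
    by (auto simp: square_side_def split: prod.split)
qed

text \<open>With \<open>(x, y) = sides (p, q) i\<close>, the invariant is that \<open>L i\<close>
  has \<open>g * x\<close> rows of length \<open>y\<close> and \<open>M i\<close> has
  \<open>g * y\<close> rows of length \<open>x\<close>. If \<open>x \<le> y\<close>, their
  intersection has \<open>g * x\<close> rows of length \<open>x\<close>; removing it leaves columns
  of \<open>L i\<close> and rows of \<open>M i\<close>, which is the invariant for
  \<open>(x, y - x)\<close>. The other case is symmetric.\<close>

lemma strip_type_rectangles:
  assumes "strip_type (rect_partition q (g * p)) (rect_partition p (g * q)) \<nu>"
  shows "\<nu> t = g * (square_side p q t)\<^sup>2"
proof -
  from assms obtain r L M where
    L0: "L 0 = rect_partition q (g * p)" and M0: "M 0 = rect_partition p (g * q)"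
    and Lr: "L r = (\<lambda>_. 0)"
    and LR: "\<And>i. i < r \<Longrightarrow> LR_coeff (L i) (inf (L i) (M i)) (L (Suc i)) \<noteq> 0"
      "\<And>i. i < r \<Longrightarrow> LR_coeff (M i) (inf (L i) (M i)) (M (Suc i)) \<noteq> 0"
    and nu: "\<nu> = (\<lambda>i. if i < r then psize (inf (L i) (M i)) else 0)"
    unfolding strip_type_def by blast
  have LM: "L i = rect_partition (snd (sides (p, q) i)) (g * fst (sides (p, q) i)) \<and>
    M i = rect_partition (fst (sides (p, q) i)) (g * snd (sides (p, q) i))" if "i \<le> r" for i
    using that
  proof (induction i)
    case 0
    then show ?case using L0 M0 by simp
  next
    case (Suc i)
    obtain x y where xy: "sides (p, q) i = (x, y)" by fastforce
    from Suc have Li: "L i = rect_partition y (g * x)" and Mi: "M i = rect_partition x (g * y)"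
      by (auto simp: xy)
    have i: "i < r" using Suc.prems by simp
    note LR = LR[OF i, unfolded Li Mi inf_rect_partition]
    show ?case
    proof (cases "x \<le> y")
      case True
      then have *: "min y x = x" "min (g * x) (g * y) = g * x"
        by (auto simp: min_def)
      show ?thesis
        using LR_coeff_rectangle_columns[OF LR(1)[unfolded *]]
          LR_coeff_rectangle_rows[OF LR(2)[unfolded *]] True
        by (simp add: xy diff_mult_distrib2)
    next
      case False
      then have *: "min y x = y" "min (g * x) (g * y) = g * y"
        by (auto simp: min_def)
      show ?thesis
        using LR_coeff_rectangle_rows[OF LR(1)[unfolded *]]
          LR_coeff_rectangle_columns[OF LR(2)[unfolded *]] False
        by (simp add: xy diff_mult_distrib2)
    qed
  qed
  show ?thesis
  proof (cases "t < r")
    case True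
    then show ?thesis
      using LM[of t] unfolding nu
      by (cases "sides (p, q) t")
        (simp add: inf_rect_partition psize_rect_partition square_side_def power2_eq_square
          min.commute flip: nat_mult_min_right)
  next
    case False
    \<comment> \<open>The chain ends at the empty partition, so the algorithm has exhausted a side
      by then and the squares from \<open>r\<close> on vanish, as \<open>\<nu>\<close> does.\<close>
    have "fst (sides (p, q) r) = 0 \<or> snd (sides (p, q) r) = 0 \<or> g = 0"
    proof (rule ccontr)
      assume "\<not> ?thesis"
      then have "L r 0 \<noteq> 0" using LM[of r] by (simp add: rect_partition_def)
      then show False by (simp add: Lr)
    qed
    then have "g = 0 \<or> square_side p q r = 0"
      by (auto simp: square_side_def split: prod.split)
    moreover have "square_side p q t \<le> square_side p q r"
      using square_side_antimono[of p q] False by (auto simp: antimono_def)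
    ultimately show ?thesis using False by (auto simp: nu)
  qed
qed

section \<open>Spectral decomposition\<close>

lemma mat_adjoint_carrier [simp]:
  "A \<in> carrier_mat n m \<Longrightarrow> mat_adjoint A \<in> carrier_mat m n"
  by (auto simp: mat_adjoint_def mat_of_rows_def)

lemma dim_mat_adjoint [simp]:
  "dim_row (mat_adjoint A) = dim_col A" "dim_col (mat_adjoint A) = dim_row A"
  by (auto simp: mat_adjoint_def mat_of_rows_def)

lemma index_mat_adjoint [simp]:
  fixes A :: "complex mat"
  assumes "i < dim_col A" "j < dim_row A"
  shows "mat_adjoint A $$ (i, j) = cnj (A $$ (j, i))"
  using assms by (simp add: mat_adjoint_def mat_of_rows_def)

lemma mat_adjoint_adjoint [simp]: "mat_adjoint (mat_adjoint A) = (A :: complex mat)"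
  by (rule eq_matI) auto

lemma mat_adjoint_one [simp]: "mat_adjoint (1\<^sub>m n) = (1\<^sub>m n :: complex mat)"
  by (rule eq_matI) auto

lemma mat_adjoint_minus:
  fixes A B :: "complex mat"
  assumes "A \<in> carrier_mat n m" "B \<in> carrier_mat n m"
  shows "mat_adjoint (A - B) = mat_adjoint A - mat_adjoint B"
  using assms by (intro eq_matI) auto

lemma mat_adjoint_smult: "mat_adjoint (c \<cdot>\<^sub>m A) = cnj c \<cdot>\<^sub>m mat_adjoint A"
  by (rule eq_matI) auto

lemma mat_adjoint_mult:
  fixes A B :: "complex mat"
  assumes "A \<in> carrier_mat n m" "B \<in> carrier_mat m l"
  shows "mat_adjoint (A * B) = mat_adjoint B * mat_adjoint A"
  using assms by (intro eq_matI) (auto simp: scalar_prod_def mult.commute)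

text \<open>Complete \<open>v\<close> to a basis and apply Gram-Schmidt, which keeps the first
  vector; dividing each column by its length makes the matrix unitary, and \<open>c\<close> is the
  inverse length of \<open>v\<close>.\<close>

lemma unitary_first_column:
  assumes v: "v \<in> carrier_vec n" "v \<noteq> 0\<^sub>v n"
  obtains W :: "complex mat" and c where "W \<in> carrier_mat n n" "mat_adjoint W * W = 1\<^sub>m n"
    "W * mat_adjoint W = 1\<^sub>m n" "c \<noteq> 0" "col W 0 = c \<cdot>\<^sub>v v"
proof -
  interpret cof_vec_space n "TYPE(complex)" .
  define b where "b = basis_completion v"
  define ws where "ws = gram_schmidt n b"
  note bc = basis_completion[OF v, folded b_def]
  have len: "length b = n" and hd: "hd b = v" using bc by auto
  have n: "n > 0" using v by (cases n) auto
  with hd len obtain vs where bv: "b = v # vs" by (cases b) auto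
  from gram_schmidt_result[OF _ _ _ ws_def] bc
  have ws: "set ws \<subseteq> carrier_vec n" "corthogonal ws" "length ws = n" by auto
  have hdws: "ws ! 0 = v"
    using gram_schmidt_hd[OF v(1), of vs, folded bv ws_def] ws(3) n by (cases ws) auto
  have carr: "ws ! i \<in> carrier_vec n" if "i < n" for i using ws that by auto
  define s where "s = (\<lambda>i. Re (ws ! i \<bullet>c ws ! i))"
  have sq: "ws ! i \<bullet>c ws ! i = complex_of_real (s i)" "s i > 0" if "i < n" for i
  proof -
    \<comment> \<open>\<open>corthogonal\<close> says that the inner product vanishes exactly for
      distinct indices, so the diagonal products are nonzero.\<close>
    have "ws ! i \<bullet>c ws ! i \<noteq> 0"
      using corthogonalD[OF ws(2), of i i] ws(3) that by auto
    moreover have "ws ! i \<bullet>c ws ! i \<ge> 0" by (rule conjugate_square_ge_0_vec)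
    ultimately show "ws ! i \<bullet>c ws ! i = complex_of_real (s i)" "s i > 0"
      by (auto simp: s_def less_eq_complex_def complex_eq_iff)
  qed
  define W where "W = mat n n (\<lambda>(i, j). ws ! j $ i / complex_of_real (sqrt (s j)))"
  have W: "W \<in> carrier_mat n n" by (simp add: W_def)
  have WW: "mat_adjoint W * W = 1\<^sub>m n"
  proof (rule eq_matI)
    fix i j assume "i < dim_row (1\<^sub>m n)" "j < dim_col (1\<^sub>m n)"
    then have ij: "i < n" "j < n" by auto
    have "(mat_adjoint W * W) $$ (i, j)
      = (ws ! j \<bullet>c ws ! i) / (complex_of_real (sqrt (s i)) * complex_of_real (sqrt (s j)))"
      using ij W carr[of i] carr[of j]
      by (auto simp: scalar_prod_def W_def sum_divide_distrib mult.commute intro!: sum.cong)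
    also have "\<dots> = 1\<^sub>m n $$ (i, j)"
    proof (cases "i = j")
      case True
      have "complex_of_real (sqrt (s j)) * complex_of_real (sqrt (s j)) = complex_of_real (s j)"
        using sq(2)[of j] ij by (metis of_real_mult real_sqrt_mult_self abs_of_pos)
      then show ?thesis using sq[of j] True ij by simp
    next
      case False
      then have "ws ! j \<bullet>c ws ! i = 0"
        using corthogonalD[OF ws(2), of j i] ws(3) ij by auto
      then show ?thesis using False ij by simp
    qed
    finally show "(mat_adjoint W * W) $$ (i, j) = 1\<^sub>m n $$ (i, j)" .
  qed (use W in auto)
  have WW': "W * mat_adjoint W = 1\<^sub>m n"
    using mat_mult_left_right_inverse[OF _ W WW] W by simp
  have "col W 0 = (1 / complex_of_real (sqrt (s 0))) \<cdot>\<^sub>v v"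
    using n W v(1) by (intro eq_vecI) (auto simp: W_def hdws)
  moreover have "1 / complex_of_real (sqrt (s 0)) \<noteq> 0" using sq(2)[OF n] by simp
  ultimately show thesis using that W WW WW' by blast
qed

lemma mat_adjoint_four_block:
  fixes A B C D :: "complex mat"
  assumes "A \<in> carrier_mat n1 m1" "B \<in> carrier_mat n1 m2"
    "C \<in> carrier_mat n2 m1" "D \<in> carrier_mat n2 m2"
  shows "mat_adjoint (four_block_mat A B C D)
    = four_block_mat (mat_adjoint A) (mat_adjoint C) (mat_adjoint B) (mat_adjoint D)"
  using assms by (intro eq_matI) auto

lemma mult_block_diag_mat:
  assumes "A \<in> carrier_mat n1 n1" "B \<in> carrier_mat n1 n1"
    and "C \<in> carrier_mat n2 n2" "D \<in> carrier_mat n2 n2"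
  shows "four_block_mat A (0\<^sub>m n1 n2) (0\<^sub>m n2 n1) C * four_block_mat B (0\<^sub>m n1 n2) (0\<^sub>m n2 n1) D
    = four_block_mat (A * B) (0\<^sub>m n1 n2) (0\<^sub>m n2 n1) (C * D)"
  using assms by (subst mult_four_block_mat[of _ n1 n1 _ n2 _ n2 _ _ n1 _ n2])
    (auto intro!: cong_four_block_mat)

text \<open>Deflation: conjugation by a unitary whose first column is an eigenvector clears the
  first column below the diagonal. Hermiticity then clears the first row, and induction applies to
  the remaining block \<open>B'\<close>.\<close>

lemma hermitian_diagonalization:
  fixes A :: "complex mat"
  assumes "A \<in> carrier_mat n n" "mat_adjoint A = A"
  shows "\<exists>U d. U \<in> carrier_mat n n \<and> mat_adjoint U * U = 1\<^sub>m n \<and> U * mat_adjoint U = 1\<^sub>m n \<and>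
    A = U * mat_diag n d * mat_adjoint U"
  using assms
proof (induction n arbitrary: A)
  case 0
  then show ?case by (intro exI[of _ "1\<^sub>m 0"] exI[of _ "\<lambda>_. 0"]) auto
next
  case (Suc n)
  note A = Suc.prems(1)
  obtain e where "eigenvalue A e"
  proof -
    obtain as where as: "char_poly A = (\<Prod>a\<leftarrow>as. [:- a, 1:])" "length as = Suc n"
      using char_poly_factorized[OF A] by blast
    then have "poly (char_poly A) (hd as) = 0"
      by (cases as) auto
    with eigenvalue_root_char_poly[OF A] that show thesis by blast
  qed
  then obtain v where v: "v \<in> carrier_vec (Suc n)" "v \<noteq> 0\<^sub>v (Suc n)" "A *\<^sub>v v = e \<cdot>\<^sub>v v"
    using A unfolding eigenvalue_def eigenvector_def by auto
  obtain W c where W: "W \<in> carrier_mat (Suc n) (Suc n)" "mat_adjoint W * W = 1\<^sub>m (Suc n)"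
    "W * mat_adjoint W = 1\<^sub>m (Suc n)" "col W 0 = c \<cdot>\<^sub>v v"
    by (rule unitary_first_column[OF v(1,2)])
  define B where "B = mat_adjoint W * A * W"
  have B: "B \<in> carrier_mat (Suc n) (Suc n)" using A W by (auto simp: B_def)
  have WBW: "A = W * B * mat_adjoint W"
  proof -
    have "W * B * mat_adjoint W = (W * mat_adjoint W) * A * (W * mat_adjoint W)"
      using A W(1) by (simp add: B_def assoc_mult_mat[of _ "Suc n" "Suc n" _ "Suc n" _ "Suc n"]
          mult_carrier_mat[of _ "Suc n" "Suc n" _ "Suc n"])
    then show ?thesis using A W by simp
  qed
  have Bherm: "mat_adjoint B = B"
    using A W(1) Suc.prems(2)
    by (simp add: B_def mat_adjoint_mult[of _ "Suc n" "Suc n" _ "Suc n"]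
        assoc_mult_mat[of _ "Suc n" "Suc n" _ "Suc n" _ "Suc n"])
  have col0: "B $$ (i, 0) = (if i = 0 then e else 0)" if i: "i < Suc n" for i
  proof -
    have "A *\<^sub>v col W 0 = e \<cdot>\<^sub>v col W 0"
      using A v W(4) by (simp add: mult_mat_vec smult_smult_assoc mult.commute)
    then have "col (A * W) 0 = e \<cdot>\<^sub>v col W 0"
      by (simp only: col_mult2[OF A W(1) zero_less_Suc])
    moreover have "col B 0 = mat_adjoint W *\<^sub>v col (A * W) 0"
      using A W(1) unfolding B_def
      by (simp add: assoc_mult_mat[of _ "Suc n" "Suc n" _ "Suc n" _ "Suc n"]
          col_mult2[of "mat_adjoint W" "Suc n" "Suc n" "A * W" "Suc n"])
    moreover have "mat_adjoint W *\<^sub>v (e \<cdot>\<^sub>v col W 0) = e \<cdot>\<^sub>v (mat_adjoint W *\<^sub>v col W 0)"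
      using W(1) by (intro mult_mat_vec) (auto simp: W(4) v(1))
    ultimately have "col B 0 = e \<cdot>\<^sub>v (mat_adjoint W *\<^sub>v col W 0)" by simp
    also have "mat_adjoint W *\<^sub>v col W 0 = col (1\<^sub>m (Suc n)) 0"
      using W(1,2) by (metis col_mult2 mat_adjoint_carrier zero_less_Suc)
    finally have "col B 0 $ i = (e \<cdot>\<^sub>v col (1\<^sub>m (Suc n)) 0) $ i" by simp
    then show ?thesis using i B by auto
  qed
  have row0: "B $$ (0, i) = (if i = 0 then e else 0)" if i: "i < Suc n" for i
  proof -
    have "B $$ (0, i) = cnj (B $$ (i, 0))"
      using B i Bherm by (metis carrier_matD index_mat_adjoint zero_less_Suc)
    then show ?thesis using col0[OF i] by (cases "i = 0") (auto simp: col0)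
  qed
  define B' where "B' = mat n n (\<lambda>(i, j). B $$ (Suc i, Suc j))"
  have B': "B' \<in> carrier_mat n n" by (simp add: B'_def)
  have "mat_adjoint B' = B'"
  proof (rule eq_matI)
    fix i j assume "i < dim_row B'" "j < dim_col B'"
    then have ij: "i < n" "j < n" by (auto simp: B'_def)
    have "cnj (B $$ (Suc j, Suc i)) = B $$ (Suc i, Suc j)"
      using B ij Bherm by (metis carrier_matD index_mat_adjoint Suc_less_eq)
    then show "mat_adjoint B' $$ (i, j) = B' $$ (i, j)" using ij by (simp add: B'_def)
  qed (auto simp: B'_def)
  from Suc.IH[OF B' this] obtain U d where U: "U \<in> carrier_mat n n"
    "mat_adjoint U * U = 1\<^sub>m n" "U * mat_adjoint U = 1\<^sub>m n"
    "B' = U * mat_diag n d * mat_adjoint U" by blast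
  define d' where "d' = (\<lambda>i. if i = 0 then e else d (i - 1))"
  define X where "X = four_block_mat (1\<^sub>m 1) (0\<^sub>m 1 n) (0\<^sub>m n 1) U"
  have X: "X \<in> carrier_mat (Suc n) (Suc n)" using U by (auto simp: X_def)
  have adjX: "mat_adjoint X = four_block_mat (1\<^sub>m 1) (0\<^sub>m 1 n) (0\<^sub>m n 1) (mat_adjoint U)"
    unfolding X_def using U(1)
    by (subst mat_adjoint_four_block[of _ 1 1 _ n _ n]) (auto intro!: cong_four_block_mat eq_matI)
  have D': "mat_diag (Suc n) d' = four_block_mat (mat_diag 1 (\<lambda>_. e)) (0\<^sub>m 1 n) (0\<^sub>m n 1) (mat_diag n d)"
    by (rule eq_matI) (auto simp: d'_def mat_diag_def)
  have XX: "mat_adjoint X * X = 1\<^sub>m (Suc n)" "X * mat_adjoint X = 1\<^sub>m (Suc n)"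
    unfolding adjX unfolding X_def using U(1,2,3)
    by (simp_all add: mult_block_diag_mat plus_1_eq_Suc del: One_nat_def)
  have "X * mat_diag (Suc n) d' * mat_adjoint X
      = four_block_mat (1\<^sub>m 1 * mat_diag 1 (\<lambda>_. e) * 1\<^sub>m 1) (0\<^sub>m 1 n) (0\<^sub>m n 1)
          (U * mat_diag n d * mat_adjoint U)"
    unfolding adjX D' unfolding X_def using U
    by (subst mult_block_diag_mat, auto simp: mult_carrier_mat[of _ "Suc 0" "Suc 0" _ "Suc 0"])+
  also have "\<dots> = four_block_mat (mat_diag 1 (\<lambda>_. e)) (0\<^sub>m 1 n) (0\<^sub>m n 1) B'"
    by (simp add: U(4) left_mult_one_mat[of _ "Suc 0" "Suc 0"] right_mult_one_mat[of _ "Suc 0" "Suc 0"])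
  also have "\<dots> = B"
    using B row0 col0 by (intro eq_matI) (auto simp: B'_def mat_diag_def)
  finally have Beq: "B = X * mat_diag (Suc n) d' * mat_adjoint X" ..
  show ?case
  proof (intro exI conjI)
    show "W * X \<in> carrier_mat (Suc n) (Suc n)" using W X by auto
    have adj: "mat_adjoint (W * X) = mat_adjoint X * mat_adjoint W"
      using W X by (simp add: mat_adjoint_mult[of _ "Suc n" "Suc n" _ "Suc n"])
    have "mat_adjoint (W * X) * (W * X) = mat_adjoint X * (mat_adjoint W * W) * X"
      using W(1) X unfolding adj
      by (simp add: assoc_mult_mat[of _ "Suc n" "Suc n" _ "Suc n" _ "Suc n"]
          mult_carrier_mat[of _ "Suc n" "Suc n" _ "Suc n"])
    then show "mat_adjoint (W * X) * (W * X) = 1\<^sub>m (Suc n)" using W X XX by simp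
    have "(W * X) * mat_adjoint (W * X) = W * (X * mat_adjoint X) * mat_adjoint W"
      using W(1) X unfolding adj
      by (simp add: assoc_mult_mat[of _ "Suc n" "Suc n" _ "Suc n" _ "Suc n"]
          mult_carrier_mat[of _ "Suc n" "Suc n" _ "Suc n"])
    then show "(W * X) * mat_adjoint (W * X) = 1\<^sub>m (Suc n)" using W X XX by simp
    have "mat_diag (Suc n) d' \<in> carrier_mat (Suc n) (Suc n)" by simp
    then show "A = W * X * mat_diag (Suc n) d' * mat_adjoint (W * X)"
      using W(1) X unfolding adj WBW Beq
      by (simp add: assoc_mult_mat[of _ "Suc n" "Suc n" _ "Suc n" _ "Suc n"]
          mult_carrier_mat[of _ "Suc n" "Suc n" _ "Suc n"])
  qed
qed

section \<open>Reading spectra off characteristic polynomials\<close>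

lemma proots_linear_factors:
  "proots (\<Prod>e\<leftarrow>es. [:- e, 1:]) = (mset es :: complex multiset)"
proof (induction es)
  case (Cons e es)
  have "(\<Prod>e\<leftarrow>es. [:- e, 1:]) \<noteq> 0" by (auto simp: prod_list_zero_iff)
  with Cons show ?case by (simp add: proots_mult del: mult_pCons_left)
qed simp

text \<open>The powers of the indeterminate permit comparing matrices of different sizes: they only
  add zero eigenvalues. Since all other eigenvalues are nonnegative, these zeros end the decreasing
  list, where padding by \<open>nth_default 0\<close> absorbs them.\<close>

lemma Spec_eqI:
  assumes cp: "[:0, 1:] ^ r * char_poly A = [:0, 1:] ^ s * (\<Prod>e\<leftarrow>es. [:- complex_of_real e, 1:])"
    and "char_poly A \<noteq> 0"
    and "sorted (rev es)" and nonneg: "\<And>e. e \<in> set es \<Longrightarrow> 0 \<le> e"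
  shows "Spec A = nth_default 0 es"
proof -
  define X where "X = image_mset Re (proots (char_poly A))"
  define xs where "xs = rev (sorted_list_of_multiset X)"
  have "proots (\<Prod>e\<leftarrow>es. [:- complex_of_real e, 1:]) = mset (map complex_of_real es)"
    using proots_linear_factors[of "map complex_of_real es"] by (simp add: comp_def)
  moreover have "(\<Prod>e\<leftarrow>es. [:- complex_of_real e, 1:]) \<noteq> 0"
    by (auto simp: prod_list_zero_iff)
  moreover have "proots ([:0, 1:] ^ k :: complex poly) = replicate_mset k 0" for k
    using proots_power[of "[:0, 1 :: complex:]" k] by (simp add: repeat_mset_replicate_mset flip: replicate_mset_Suc)
  ultimately have "replicate_mset r 0 + proots (char_poly A)
      = replicate_mset s 0 + mset (map complex_of_real es)"
    using arg_cong[OF cp, of proots] assms(2)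
    by (simp add: proots_mult del: mset_map)
  from arg_cong[OF this, of "image_mset Re"]
  have X: "replicate_mset r 0 + X = replicate_mset s 0 + mset es"
    by (simp add: X_def image_mset.compositionality comp_def)
  have "0 \<le> x" if "x \<in># X" for x
  proof -
    have "x \<in># replicate_mset s 0 + mset es" using that unfolding X[symmetric] by simp
    then show ?thesis using nonneg by (auto split: if_splits)
  qed
  then have "sorted (replicate r 0 @ rev xs)"
    by (auto simp: sorted_append xs_def)
  moreover have "sorted (replicate s 0 @ rev es)"
    using assms(3) nonneg by (auto simp: sorted_append)
  moreover have "mset (replicate r 0 @ rev xs) = mset (replicate s 0 @ rev es)"
    using X by (simp add: xs_def)
  ultimately have "replicate r 0 @ rev xs = replicate s 0 @ rev es"
    by (metis properties_for_sort)
  from arg_cong[OF this, of rev] have "xs @ replicate r 0 = es @ replicate s 0" by simp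
  then have "nth_default 0 (xs @ replicate r 0) = nth_default 0 (es @ replicate s 0)" by simp
  moreover have "nth_default 0 (zs @ replicate k 0) = nth_default 0 zs" for zs :: "real list" and k
    by (auto simp: fun_eq_iff nth_default_append nth_default_def)
  ultimately show ?thesis by (simp add: Spec_def X_def xs_def)
qed

lemma char_poly_nonzero:
  fixes A :: "complex mat"
  assumes "A \<in> carrier_mat n n"
  shows "char_poly A \<noteq> 0"
  using degree_monic_char_poly[OF assms] by auto

lemma char_poly_mat_diag:
  "char_poly (mat_diag n d) = (\<Prod>a\<leftarrow>map d [0..<n]. [:- a, 1 :: complex:])"
proof -
  have "diag_mat (mat_diag n d) = map d [0..<n]"
    by (auto simp: diag_mat_def mat_diag_def)
  moreover have "upper_triangular (mat_diag n d)"
    by (auto simp: upper_triangular_def mat_diag_def)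
  ultimately show ?thesis
    using char_poly_upper_triangular[of "mat_diag n d" n] by simp
qed

lemma char_poly_zero_mat: "char_poly (0\<^sub>m n n) = ([:0, 1:] ^ n :: complex poly)"
proof -
  have "0\<^sub>m n n = (mat_diag n (\<lambda>_. 0) :: complex mat)"
    by (rule eq_matI) (auto simp: mat_diag_def)
  then show ?thesis
    by (simp add: char_poly_mat_diag map_replicate_const)
qed

text \<open>Both block matrices below are conjugate under the shear with upper right block \<open>A\<close>.\<close>

lemma char_poly_mult_swap:
  fixes A B :: "complex mat"
  assumes A: "A \<in> carrier_mat n r" and B: "B \<in> carrier_mat r n"
  shows "[:0, 1:] ^ r * char_poly (A * B) = [:0, 1:] ^ n * char_poly (B * A)"
proof -
  define M1 where "M1 = four_block_mat (A * B) (0\<^sub>m n r) B (0\<^sub>m r r)"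
  define M2 where "M2 = four_block_mat (0\<^sub>m n n) (0\<^sub>m n r) B (B * A)"
  define P where "P = four_block_mat (1\<^sub>m n) A (0\<^sub>m r n) (1\<^sub>m r)"
  define Q where "Q = four_block_mat (1\<^sub>m n) (- A) (0\<^sub>m r n) (1\<^sub>m r)"
  note mult = mult_four_block_mat[of _ n n _ r _ r _ _ n _ r]
  have carr: "M1 \<in> carrier_mat (n + r) (n + r)" "M2 \<in> carrier_mat (n + r) (n + r)"
    "P \<in> carrier_mat (n + r) (n + r)" "Q \<in> carrier_mat (n + r) (n + r)"
    using A B by (auto simp: M1_def M2_def P_def Q_def)
  have inv: "- X + X = 0\<^sub>m k l" "X + - X = 0\<^sub>m k l" if "X \<in> carrier_mat k l" for X :: "complex mat" and k l
    using that by (auto intro!: eq_matI)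
  have zero: "- 0\<^sub>m k l + X = X" if "X \<in> carrier_mat k l" for X :: "complex mat" and k l
    using that by (auto intro!: eq_matI)
  have "P * Q = 1\<^sub>m (n + r)" "Q * P = 1\<^sub>m (n + r)"
    using A unfolding P_def Q_def
    by (auto simp: mult inv zero)
  moreover have "M1 = P * M2 * Q"
  proof -
    have PM: "P * M2 = four_block_mat (A * B) (A * (B * A)) B (B * A)"
      using A B unfolding P_def M2_def by (auto simp: mult)
    show ?thesis
      unfolding PM unfolding M1_def Q_def using A B
      by (auto simp: mult assoc_mult_mat[of _ n r _ n _ r] inv intro!: cong_four_block_mat)
  qed
  ultimately have "similar_mat M1 M2"
    using similar_mat_witI[of P Q "n + r" M1 M2] carr unfolding similar_mat_def by blast
  then have "char_poly M1 = char_poly M2" by (rule char_poly_similar)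
  \<comment> \<open>The factorizations into linear factors serve the side conditions of
    \<open>char_poly_0_block'\<close>.\<close>
  moreover have "char_poly M1 = char_poly (A * B) * char_poly (0\<^sub>m r r)"
    using A B char_poly_factorized[of "A * B" n] char_poly_factorized[of "0\<^sub>m r r" r]
    by (intro char_poly_0_block'[OF M1_def]) auto
  moreover have "char_poly M2 = char_poly (0\<^sub>m n n) * char_poly (B * A)"
    using A B char_poly_factorized[of "B * A" r] char_poly_factorized[of "0\<^sub>m n n" n]
    by (intro char_poly_0_block'[OF M2_def]) auto
  ultimately show ?thesis by (simp add: char_poly_zero_mat mult.commute)
qed

text \<open>The vectors are unit eigenvectors scaled by the square roots of their eigenvalues, so
  that their squared lengths are the eigenvalues.\<close>

lemma spectral_decomposition:
  assumes "positive_semidefinite A" and A: "A \<in> carrier_mat n n"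
  obtains y :: "nat \<Rightarrow> nat \<Rightarrow> complex"
  where "\<And>i j. i < n \<Longrightarrow> j < n \<Longrightarrow> A $$ (i, j) = (\<Sum>t<n. y t i * cnj (y t j))"
    and "\<And>t. t < n \<Longrightarrow> (\<Sum>i<n. (cmod (y t i))\<^sup>2) = Spec A t"
    and "\<And>t. n \<le> t \<Longrightarrow> Spec A t = 0"
proof -
  from assms have herm: "mat_adjoint A = A"
    and pos: "\<And>v. v \<in> carrier_vec n \<Longrightarrow> 0 \<le> (A *\<^sub>v v) \<bullet>c v"
    by (auto simp: positive_semidefinite_def)
  from hermitian_diagonalization[OF A herm] obtain U d where U: "U \<in> carrier_mat n n"
    and UU: "mat_adjoint U * U = 1\<^sub>m n" "U * mat_adjoint U = 1\<^sub>m n"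
    and AU: "A = U * mat_diag n d * mat_adjoint U" by blast
  have D: "mat_diag n d \<in> carrier_mat n n" by simp
  have AU_entry: "A $$ (i, j) = (\<Sum>t<n. U $$ (i, t) * d t * cnj (U $$ (j, t)))"
    if "i < n" "j < n" for i j
    using that U unfolding AU
    by (auto simp: mat_diag_mult_right[OF U] scalar_prod_def atLeast0LessThan intro!: sum.cong)
  have unit: "(\<Sum>i<n. cnj (U $$ (i, t)) * U $$ (i, t)) = 1" if "t < n" for t
  proof -
    have "(mat_adjoint U * U) $$ (t, t) = 1" using that UU by simp
    then show ?thesis using U that by (simp add: scalar_prod_def atLeast0LessThan)
  qed
  \<comment> \<open>The column \<open>col U t\<close> is a unit eigenvector, so \<open>d t\<close>
    is the value of the quadratic form of \<open>A\<close> there.\<close>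
  have d_nonneg: "0 \<le> d t" if t: "t < n" for t
  proof -
    have "A * U = U * mat_diag n d * (mat_adjoint U * U)"
      using U unfolding AU
      by (simp add: assoc_mult_mat[of _ n n _ n _ n] mult_carrier_mat[of _ n n _ n])
    then have "A * U = U * mat_diag n d"
      using U UU by (simp add: right_mult_one_mat[of _ n n] mult_carrier_mat[of _ n n _ n])
    then have "col (A * U) t = d t \<cdot>\<^sub>v col U t"
      using t U by (intro eq_vecI) (auto simp: mat_diag_mult_right[OF U] mult.commute)
    then have "A *\<^sub>v col U t = d t \<cdot>\<^sub>v col U t"
      by (simp only: col_mult2[OF A U t])
    moreover have "col U t \<bullet>c col U t = 1"
      using unit[OF t] U t by (simp add: scalar_prod_def atLeast0LessThan mult.commute)
    moreover have "col U t \<in> carrier_vec n" using U t by auto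
    ultimately show ?thesis using pos[of "col U t"] U by auto
  qed
  define xs where "xs = map (Re \<circ> d) [0..<n]"
  define es where "es = rev (sort xs)"
  have d_xs: "d t = complex_of_real (xs ! t)" "0 \<le> xs ! t" if "t < n" for t
    using d_nonneg[OF that] that by (auto simp: xs_def less_eq_complex_def complex_eq_iff)
  have "similar_mat A (mat_diag n d)"
    using similar_mat_witI[OF UU(2,1) AU A _ U] U unfolding similar_mat_def by auto
  then have "char_poly A = (\<Prod>a\<leftarrow>map d [0..<n]. [:- a, 1:])"
    by (simp add: char_poly_similar char_poly_mat_diag)
  also have "map d [0..<n] = map complex_of_real xs"
    using d_xs by (auto simp: xs_def intro!: nth_equalityI)
  also have "(\<Prod>a\<leftarrow>map complex_of_real xs. [:- a, 1:]) = (\<Prod>a\<leftarrow>es. [:- complex_of_real a, 1:])"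
    unfolding es_def
    by (simp flip: prod_mset_prod_list add: comp_def)
  finally have cp: "char_poly A = (\<Prod>a\<leftarrow>es. [:- complex_of_real a, 1:])" .
  have len: "length xs = n" "length es = n" by (auto simp: xs_def es_def)
  have "0 \<le> e" if "e \<in> set es" for e
  proof -
    from that have "e \<in> set xs" by (simp add: es_def)
    then show ?thesis using d_xs(2) len by (auto simp: in_set_conv_nth)
  qed
  then have Spec: "Spec A = nth_default 0 es"
    using cp char_poly_nonzero[OF A] by (intro Spec_eqI[of 0 _ 0]) (auto simp: es_def)
  have "mset es = mset xs" by (simp add: es_def)
  \<comment> \<open>The diagonalization comes in arbitrary order; \<open>\<pi>\<close> sends a
    position in the decreasing list to the matching column of \<open>U\<close>.\<close>
  then obtain \<pi> where bij: "bij_betw \<pi> {..<n} {..<n}" and \<pi>: "\<And>t. t < n \<Longrightarrow> es ! t = xs ! \<pi> t"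
    using permutation_Ex_bij[of es xs] len by auto
  have \<pi>_less: "\<pi> t < n" if "t < n" for t using bij that by (auto simp: bij_betw_def)
  define y where "y = (\<lambda>t i. complex_of_real (sqrt (xs ! \<pi> t)) * U $$ (i, \<pi> t))"
  have y_mult: "y t i * cnj (y t j) = U $$ (i, \<pi> t) * d (\<pi> t) * cnj (U $$ (j, \<pi> t))"
    if "t < n" for t i j
  proof -
    have "complex_of_real (sqrt (xs ! \<pi> t)) * complex_of_real (sqrt (xs ! \<pi> t)) = d (\<pi> t)"
      using d_xs[OF \<pi>_less[OF that]] by (simp flip: of_real_mult)
    then show ?thesis by (simp add: y_def mult_ac)
  qed
  show thesis
  proof (rule that)
    show "A $$ (i, j) = (\<Sum>t<n. y t i * cnj (y t j))" if "i < n" "j < n" for i j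
      using sum.reindex_bij_betw[OF bij, of "\<lambda>t. U $$ (i, t) * d t * cnj (U $$ (j, t))"]
      by (simp add: AU_entry[OF that] y_mult)
    show "(\<Sum>i<n. (cmod (y t i))\<^sup>2) = Spec A t" if t: "t < n" for t
    proof -
      have "complex_of_real (\<Sum>i<n. (cmod (y t i))\<^sup>2) = (\<Sum>i<n. y t i * cnj (y t i))"
        by (simp add: complex_norm_square del: of_real_power)
      also have "\<dots> = d (\<pi> t) * (\<Sum>i<n. cnj (U $$ (i, \<pi> t)) * U $$ (i, \<pi> t))"
        by (simp add: y_mult[OF t] sum_distrib_left mult_ac)
      also have "\<dots> = complex_of_real (es ! t)"
        using unit[OF \<pi>_less[OF t]] d_xs[OF \<pi>_less[OF t]] \<pi>[OF t] by simp
      finally show ?thesis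
        using t len by (simp add: Spec nth_default_nth del: of_real_sum)
    qed
    show "Spec A t = 0" if "n \<le> t" for t
      using that len by (simp add: Spec nth_default_beyond)
  qed
qed

section \<open>Ensembles with proportional marginals\<close>

text \<open>The squared Frobenius norm: for a vector reshaped into a matrix, its squared
  length.\<close>

definition frobenius :: "complex mat \<Rightarrow> real" where
  "frobenius A = (\<Sum>i<dim_row A. \<Sum>j<dim_col A. (cmod (A $$ (i, j)))\<^sup>2)"

lemma frobenius_nonneg: "0 \<le> frobenius A"
  by (auto simp: frobenius_def intro!: sum_nonneg)

lemma frobenius_adjoint: "frobenius (mat_adjoint A) = frobenius A"
  unfolding frobenius_def by (subst sum.swap) simp

lemma frobenius_eq_0:
  assumes "A \<in> carrier_mat n m" "frobenius A \<le> 0"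
  shows "A = 0\<^sub>m n m"
proof (rule eq_matI)
  fix i j assume "i < dim_row (0\<^sub>m n m :: complex mat)" "j < dim_col (0\<^sub>m n m :: complex mat)"
  then have ij: "i < n" "j < m" by auto
  have "(\<Sum>i<n. \<Sum>j<m. (cmod (A $$ (i, j)))\<^sup>2) = 0"
    using assms frobenius_nonneg[of A] by (simp add: frobenius_def)
  then have "(\<Sum>j<m. (cmod (A $$ (i, j)))\<^sup>2) = 0"
    using ij by (subst (asm) sum_nonneg_eq_0_iff) (auto intro: sum_nonneg)
  then show "A $$ (i, j) = 0\<^sub>m n m $$ (i, j)"
    using ij by (subst (asm) sum_nonneg_eq_0_iff) auto
qed (use assms in auto)

section \<open>Trace identities\<close>

lemma mat_trace_mult_adjoint: "mat_trace (A * mat_adjoint A) = complex_of_real (frobenius A)"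
  by (auto simp: mat_trace_def frobenius_def scalar_prod_def atLeast0LessThan complex_norm_square
      simp del: of_real_power intro!: sum.cong)

lemma mat_trace_mult_comm:
  assumes "A \<in> carrier_mat n m" "B \<in> carrier_mat m n"
  shows "mat_trace (A * B) = mat_trace (B * A)"
proof -
  have "mat_trace (A * B) = (\<Sum>i<n. \<Sum>j<m. A $$ (i, j) * B $$ (j, i))"
    using assms by (auto simp: mat_trace_def scalar_prod_def atLeast0LessThan)
  also have "\<dots> = (\<Sum>j<m. \<Sum>i<n. A $$ (i, j) * B $$ (j, i))" by (rule sum.swap)
  also have "\<dots> = mat_trace (B * A)"
    using assms by (auto simp: mat_trace_def scalar_prod_def atLeast0LessThan mult.commute)
  finally show ?thesis .
qed

lemma mat_trace_minus:
  assumes "A \<in> carrier_mat n n" "B \<in> carrier_mat n n"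
  shows "mat_trace (A - B) = mat_trace A - mat_trace B"
  using assms by (auto simp: mat_trace_def sum_subtractf)

lemma mat_trace_smult:
  assumes "A \<in> carrier_mat n n"
  shows "mat_trace (c \<cdot>\<^sub>m A) = c * mat_trace A"
  using assms by (auto simp: mat_trace_def sum_distrib_left)

lemma mat_diff_eq_zero:
  fixes A B :: "complex mat"
  assumes "A \<in> carrier_mat n m" "B \<in> carrier_mat n m" "A - B = 0\<^sub>m n m"
  shows "B = A"
proof (rule eq_matI)
  fix i j assume "i < dim_row A" "j < dim_col A"
  then have "(A - B) $$ (i, j) = 0" "i < n" "j < m" using assms by auto
  then show "B $$ (i, j) = A $$ (i, j)" using assms(1,2) by simp
qed (use assms in auto)

text \<open>Orthogonal projections of rank \<open>x\<close>. The rank is recorded as the trace,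
  which is additive when a subprojection is split off.\<close>

definition projection :: "nat \<Rightarrow> nat \<Rightarrow> complex mat \<Rightarrow> bool" where
  "projection n x P \<longleftrightarrow> P \<in> carrier_mat n n \<and> mat_adjoint P = P \<and> P * P = P \<and> mat_trace P = of_nat x"

text \<open>The factors \<open>u * y\<close> and \<open>u * x\<close> give both sums the trace \<open>u * x * y\<close>, and they keep \<open>u\<close>
  unchanged when a square is split off.\<close>

definition ensemble :: "nat \<Rightarrow> nat \<Rightarrow> real \<Rightarrow> nat set \<Rightarrow> (nat \<Rightarrow> complex mat) \<Rightarrow>
    nat \<Rightarrow> nat \<Rightarrow> complex mat \<Rightarrow> complex mat \<Rightarrow> bool" where
  "ensemble n m u I Y x y P Q \<longleftrightarrow> finite I \<and> projection n x P \<and> projection m y Q \<and>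
     (\<forall>t\<in>I. Y t \<in> carrier_mat n m) \<and>
     (\<forall>i<n. \<forall>j<n. (\<Sum>t\<in>I. (Y t * mat_adjoint (Y t)) $$ (i, j)) = u * y * P $$ (i, j)) \<and>
     (\<forall>i<m. \<forall>j<m. (\<Sum>t\<in>I. (mat_adjoint (Y t) * Y t) $$ (i, j)) = u * x * Q $$ (i, j))"

text \<open>This symmetry lets each bound be proved for one marginal only.\<close>

lemma ensemble_adjoint:
  assumes "ensemble n m u I Y x y P Q"
  shows "ensemble m n u I (\<lambda>t. mat_adjoint (Y t)) y x Q P"
  using assms by (auto simp: ensemble_def)

lemma mat_trace_mult_sum:
  assumes "X \<in> carrier_mat n n" "P \<in> carrier_mat n n" "\<And>t. t \<in> I \<Longrightarrow> A t \<in> carrier_mat n n"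
    and "\<And>i j. i < n \<Longrightarrow> j < n \<Longrightarrow> (\<Sum>t\<in>I. A t $$ (i, j)) = c * P $$ (i, j)"
  shows "(\<Sum>t\<in>I. mat_trace (X * A t)) = c * mat_trace (X * P)"
proof -
  have "(\<Sum>t\<in>I. mat_trace (X * A t)) = (\<Sum>t\<in>I. \<Sum>i<n. \<Sum>j<n. X $$ (i, j) * A t $$ (j, i))"
  proof (rule sum.cong[OF refl])
    fix t assume "t \<in> I"
    from assms(1) assms(3)[OF this]
    show "mat_trace (X * A t) = (\<Sum>i<n. \<Sum>j<n. X $$ (i, j) * A t $$ (j, i))"
      by (auto simp: mat_trace_def scalar_prod_def atLeast0LessThan)
  qed
  also have "\<dots> = (\<Sum>i<n. \<Sum>j<n. X $$ (i, j) * (\<Sum>t\<in>I. A t $$ (j, i)))"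
    by (simp add: sum.swap[of _ _ I] sum_distrib_left)
  also have "\<dots> = c * (\<Sum>i<n. \<Sum>j<n. X $$ (i, j) * P $$ (j, i))"
    using assms(4) by (simp add: sum_distrib_left mult_ac)
  also have "(\<Sum>i<n. \<Sum>j<n. X $$ (i, j) * P $$ (j, i)) = mat_trace (X * P)"
    using assms(1,2) by (auto simp: mat_trace_def scalar_prod_def atLeast0LessThan)
  finally show ?thesis .
qed

text \<open>The complement \<open>R\<close> of \<open>P\<close> is again self-adjoint and
  idempotent, so by cyclicity of the trace one of the two factors \<open>R\<close> absorbs the
  other.\<close>

lemma projection_complement_trace:
  assumes P: "projection n x P" and Y: "Y \<in> carrier_mat n m"
  shows "complex_of_real (frobenius ((1\<^sub>m n - P) * Y))
    = mat_trace ((1\<^sub>m n - P) * (Y * mat_adjoint Y))"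
proof -
  define R where "R = 1\<^sub>m n - P"
  have P': "P \<in> carrier_mat n n" "mat_adjoint P = P" "P * P = P" using P by (auto simp: projection_def)
  have R: "R \<in> carrier_mat n n" using P' by (simp add: R_def minus_carrier_mat)
  have adjR: "mat_adjoint R = R"
    using P' by (simp add: R_def mat_adjoint_minus[of _ n n])
  have RR: "R * R = R"
  proof -
    have "R * R = (1\<^sub>m n - P) - (1\<^sub>m n - P) * P"
      unfolding R_def using P' R[unfolded R_def]
      by (subst mult_minus_distrib_mat[of _ n n _ n]) auto
    also have "(1\<^sub>m n - P) * P = 0\<^sub>m n n"
      using P' by (subst minus_mult_distrib_mat[of _ n n _ _ n]) auto
    finally have "R * R = R - 0\<^sub>m n n" by (simp add: R_def)
    then show ?thesis using R by (auto intro!: eq_matI)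
  qed
  have "mat_trace ((R * Y) * mat_adjoint (R * Y)) = mat_trace ((R * (Y * mat_adjoint Y)) * R)"
    using R Y by (simp add: mat_adjoint_mult[of _ n n _ m] adjR
        assoc_mult_mat[of _ n n _ m _ n] assoc_mult_mat[of _ n n _ n _ n] assoc_mult_mat[of _ n m _ n _ n]
        mult_carrier_mat[of _ n m _ n] mult_carrier_mat[of _ m n _ n])
  also have "\<dots> = mat_trace (R * (R * (Y * mat_adjoint Y)))"
    using R Y by (intro mat_trace_mult_comm[of _ n n]) auto
  also have "R * (R * (Y * mat_adjoint Y)) = (R * R) * (Y * mat_adjoint Y)"
    using R Y by (simp add: assoc_mult_mat[of _ n n _ n _ n])
  finally show ?thesis by (simp add: RR mat_trace_mult_adjoint flip: R_def)
qed

text \<open>Tracing the first marginal against \<open>1 - P\<close> gives zero because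
  \<open>(1 - P) * P\<close> vanishes. The trace is a sum of squared norms of
  \<open>(1 - P) * Y s\<close>, so every one of them vanishes.\<close>

lemma ensemble_support:
  assumes E: "ensemble n m u I Y x y P Q" and t: "t \<in> I"
  shows "P * Y t = Y t"
proof -
  have P: "projection n x P" and Y: "\<And>t. t \<in> I \<Longrightarrow> Y t \<in> carrier_mat n m" and fin: "finite I"
    using E by (auto simp: ensemble_def)
  then have P': "P \<in> carrier_mat n n" "P * P = P" by (auto simp: projection_def)
  have R: "1\<^sub>m n - P \<in> carrier_mat n n" using P' by (simp add: minus_carrier_mat)
  have RP: "(1\<^sub>m n - P) * P = 0\<^sub>m n n"
    using P' by (subst minus_mult_distrib_mat[of _ n n _ _ n]) auto
  have "complex_of_real (\<Sum>s\<in>I. frobenius ((1\<^sub>m n - P) * Y s))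
      = (\<Sum>s\<in>I. mat_trace ((1\<^sub>m n - P) * (Y s * mat_adjoint (Y s))))"
    using projection_complement_trace[OF P Y] by simp
  also have "\<dots> = (u * y) * mat_trace ((1\<^sub>m n - P) * P)"
    using E Y by (intro mat_trace_mult_sum[OF R P'(1)])
      (auto simp: ensemble_def intro!: mult_carrier_mat[of _ n m])
  also have "\<dots> = 0" by (simp add: RP mat_trace_def)
  finally have "(\<Sum>s\<in>I. frobenius ((1\<^sub>m n - P) * Y s)) = 0" by (simp del: of_real_sum)
  then have "frobenius ((1\<^sub>m n - P) * Y t) = 0"
    using fin t by (subst (asm) sum_nonneg_eq_0_iff) (auto intro: frobenius_nonneg)
  then have "(1\<^sub>m n - P) * Y t = 0\<^sub>m n m"
    using R Y[OF t] by (intro frobenius_eq_0) auto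
  then have "Y t - P * Y t = 0\<^sub>m n m"
    using P' Y[OF t] by (subst (asm) minus_mult_distrib_mat[of _ n n _ _ m]) auto
  moreover have "P * Y t \<in> carrier_mat n m" using P' Y[OF t] by auto
  ultimately show ?thesis
    using mat_diff_eq_zero[OF Y[OF t]] by simp
qed

lemma mat_trace_gram_mult:
  fixes X Y :: "complex mat"
  assumes "X \<in> carrier_mat n m" "Y \<in> carrier_mat n m"
  shows "mat_trace ((mat_adjoint X * X) * (mat_adjoint Y * Y))
    = complex_of_real (frobenius (X * mat_adjoint Y))"
proof -
  note assoc = assoc_mult_mat[of _ m n _ m _ m] assoc_mult_mat[of _ n m _ n _ m]
    assoc_mult_mat[of _ n m _ n _ n] assoc_mult_mat[of _ n m _ m _ n] assoc_mult_mat[of _ m n _ m _ n]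
    mult_carrier_mat[of _ n m _ n] mult_carrier_mat[of _ m n _ m] mult_carrier_mat[of _ n m _ m]
  have "(mat_adjoint X * X) * (mat_adjoint Y * Y) = mat_adjoint X * (X * mat_adjoint Y * Y)"
    using assms by (simp add: assoc)
  also have "mat_trace \<dots> = mat_trace ((X * mat_adjoint Y * Y) * mat_adjoint X)"
    using assms by (intro mat_trace_mult_comm[of _ m n] mult_carrier_mat[of _ n n] mult_carrier_mat[of X n m]) auto
  also have "(X * mat_adjoint Y * Y) * mat_adjoint X = (X * mat_adjoint Y) * mat_adjoint (X * mat_adjoint Y)"
    using assms by (simp add: assoc mat_adjoint_mult[of _ n m _ n])
  finally show ?thesis by (simp add: mat_trace_mult_adjoint)
qed

lemma mat_trace_gram:
  fixes Y :: "complex mat"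
  assumes "Y \<in> carrier_mat n m"
  shows "mat_trace (mat_adjoint Y * Y) = complex_of_real (frobenius Y)"
  using mat_trace_mult_comm[of "mat_adjoint Y" m n Y] assms by (simp add: mat_trace_mult_adjoint)

text \<open>The trace of \<open>Y\<^sub>t\<^sup>* Y\<^sub>t\<close> against the second marginal is a sum of the squared norms of
  \<open>Y\<^sub>t Y\<^sub>s\<^sup>*\<close>; only the term \<open>s = t\<close> is kept.\<close>

lemma ensemble_gram_bound:
  assumes E: "ensemble n m u I Y x y P Q" and t: "t \<in> I"
  shows "frobenius (Y t * mat_adjoint (Y t)) \<le> u * x * frobenius (Y t)"
proof -
  have Y: "\<And>t. t \<in> I \<Longrightarrow> Y t \<in> carrier_mat n m" and fin: "finite I" and Q: "Q \<in> carrier_mat m m"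
    "mat_adjoint Q = Q"
    using E by (auto simp: ensemble_def projection_def)
  let ?B = "mat_adjoint (Y t) * Y t"
  have QY: "Q * mat_adjoint (Y t) = mat_adjoint (Y t)"
    using ensemble_support[OF ensemble_adjoint[OF E] t] .
  have "complex_of_real (\<Sum>s\<in>I. frobenius (Y t * mat_adjoint (Y s)))
      = (\<Sum>s\<in>I. mat_trace (?B * (mat_adjoint (Y s) * Y s)))"
    using Y[OF t] Y by (simp add: mat_trace_gram_mult)
  also have "\<dots> = (u * x) * mat_trace (?B * Q)"
    using E Y t Q by (intro mat_trace_mult_sum)
      (auto simp: ensemble_def intro!: mult_carrier_mat[of _ m n])
  \<comment> \<open>The range of \<open>?B\<close> lies in that of \<open>Q\<close>, so
    \<open>Q\<close> acts on \<open>?B\<close> as the identity.\<close>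
  also have "mat_trace (?B * Q) = mat_trace (Q * ?B)"
    using Y[OF t] Q by (intro mat_trace_mult_comm[of _ m m]) auto
  also have "Q * ?B = ?B"
    using Y[OF t] Q by (subst assoc_mult_mat[of Q m m _ n _ m, symmetric]) (auto simp: QY)
  finally have "complex_of_real (\<Sum>s\<in>I. frobenius (Y t * mat_adjoint (Y s)))
      = complex_of_real (u * x * frobenius (Y t))"
    by (simp only: mat_trace_gram[OF Y[OF t]] of_real_mult of_real_of_nat_eq)
  then have "(\<Sum>s\<in>I. frobenius (Y t * mat_adjoint (Y s))) = u * x * frobenius (Y t)"
    by (simp only: of_real_eq_iff)
  moreover have "frobenius (Y t * mat_adjoint (Y t)) \<le> (\<Sum>s\<in>I. frobenius (Y t * mat_adjoint (Y s)))"
    using fin t by (intro member_le_sum) (auto intro: frobenius_nonneg)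
  ultimately show ?thesis by simp
qed

text \<open>Write \<open>A\<close> for \<open>Y t * mat_adjoint (Y t)\<close> and
  \<open>d = u * x\<close>. As \<open>P\<close> fixes \<open>A\<close>, the left side expands to
  \<open>frobenius A - 2 * d * frobenius (Y t) + d\<^sup>2 * x\<close>, and
  \<open>ensemble_gram_bound\<close> estimates the first term. The result yields both the bound on
  the weight and its equality case.\<close>

lemma ensemble_deviation:
  assumes E: "ensemble n m u I Y x y P Q" and t: "t \<in> I"
  shows "frobenius (Y t * mat_adjoint (Y t) - complex_of_real (u * x) \<cdot>\<^sub>m P)
    \<le> u * x * (u * x * x - frobenius (Y t))"
proof -
  define A where "A = Y t * mat_adjoint (Y t)"
  define d where "d = u * x"
  have Y: "Y t \<in> carrier_mat n m" and P: "P \<in> carrier_mat n n" "mat_adjoint P = P" "P * P = P"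
    "mat_trace P = of_nat x"
    using E t by (auto simp: ensemble_def projection_def)
  have A: "A \<in> carrier_mat n n" using Y by (auto simp: A_def)
  have adjA: "mat_adjoint A = A" using Y by (simp add: A_def mat_adjoint_mult[of _ n m _ n])
  have PA: "P * A = A"
    unfolding A_def using Y P ensemble_support[OF E t]
    by (subst assoc_mult_mat[of P n n _ m _ n, symmetric]) auto
  then have AP: "A * P = A"
    using mat_adjoint_mult[OF P(1) A] by (simp add: adjA P)
  define S where "S = A - complex_of_real d \<cdot>\<^sub>m P"
  have S: "S \<in> carrier_mat n n" using A P by (simp add: S_def minus_carrier_mat)
  have adjS: "mat_adjoint S = S"
    using A P by (simp add: S_def mat_adjoint_minus[of _ n n] mat_adjoint_smult adjA)
  have "S * S = A * S - complex_of_real d \<cdot>\<^sub>m (P * S)"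
    using A P S by (subst (1) S_def) (simp add: minus_mult_distrib_mat[of _ n n _ _ n] mult_smult_assoc_mat[of _ n n _ n])
  also have "A * S = A * A - complex_of_real d \<cdot>\<^sub>m A"
    using A P by (simp add: S_def mult_minus_distrib_mat[of _ n n _ n] mult_smult_distrib[of _ n n] AP)
  also have "P * S = S"
    using A P by (simp add: S_def mult_minus_distrib_mat[of _ n n _ n] mult_smult_distrib[of _ n n] PA)
  finally have "mat_trace (S * S) = mat_trace (A * A) - d * mat_trace A - d * mat_trace S"
    using A S by (simp add: mat_trace_minus[of _ n] mat_trace_smult[of _ n] minus_carrier_mat mult_carrier_mat[of _ n n])
  moreover have "mat_trace S = mat_trace A - d * of_nat x"
    using A P by (simp add: S_def mat_trace_minus[of _ n] mat_trace_smult[of _ n])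
  moreover have "mat_trace A = complex_of_real (frobenius (Y t))"
    by (simp add: A_def mat_trace_mult_adjoint)
  moreover have "mat_trace (A * A) = complex_of_real (frobenius A)"
    using mat_trace_mult_adjoint[of A] by (simp add: adjA)
  moreover have "mat_trace (S * S) = complex_of_real (frobenius S)"
    using mat_trace_mult_adjoint[of S] by (simp add: adjS)
  ultimately have "complex_of_real (frobenius S)
    = complex_of_real (frobenius A - d * frobenius (Y t) - d * (frobenius (Y t) - d * x))" by simp
  then have "frobenius S = frobenius A - d * frobenius (Y t) - d * (frobenius (Y t) - d * x)"
    by (simp only: of_real_eq_iff)
  with ensemble_gram_bound[OF E t] show ?thesis
    by (simp add: S_def A_def d_def algebra_simps)
qed

lemma projection_0:
  assumes "projection n 0 P"
  shows "P = 0\<^sub>m n n"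
proof (rule frobenius_eq_0)
  have "mat_trace (P * mat_adjoint P) = 0" using assms by (simp add: projection_def)
  then show "frobenius P \<le> 0" by (simp add: mat_trace_mult_adjoint)
qed (use assms in \<open>simp add: projection_def\<close>)

text \<open>The left side of \<open>ensemble_deviation\<close> is nonnegative and
  \<open>u * x\<close> can be cancelled. For \<open>x = 0\<close> instead, \<open>P\<close> is zero
  and forces \<open>Y t\<close> to be zero.\<close>

lemma ensemble_weight_le:
  assumes E: "ensemble n m u I Y x y P Q" and t: "t \<in> I" and u: "0 < u"
  shows "frobenius (Y t) \<le> u * (real x)\<^sup>2"
proof (cases "x = 0")
  case True
  with E have "P = 0\<^sub>m n n" by (auto simp: ensemble_def intro!: projection_0)
  moreover have "Y t \<in> carrier_mat n m" using E t by (auto simp: ensemble_def)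
  ultimately have "Y t = 0\<^sub>m n m"
    using ensemble_support[OF E t] by (simp add: left_mult_zero_mat)
  then show ?thesis using True by (simp add: frobenius_def)
next
  case False
  have "0 \<le> u * x * (u * x * x - frobenius (Y t))"
    using ensemble_deviation[OF E t] frobenius_nonneg order_trans by blast
  moreover have "0 < u * x" using False u by simp
  ultimately have "0 \<le> u * x * x - frobenius (Y t)" by (simp only: zero_le_mult_iff) linarith
  then show ?thesis by (simp add: power2_eq_square mult.assoc)
qed

text \<open>If \<open>Y t\<close> attains the bound, then \<open>Y\<^sup>* Y\<close> is a multiple of a subprojection of \<open>Q\<close>, which can be
  split off.\<close>

lemma ensemble_split_off:
  assumes E: "ensemble n m u I Y x y P Q" and t: "t \<in> I" and u: "0 < u" and xy: "x \<le> y"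
    and eq: "frobenius (Y t) = u * (real x)\<^sup>2"
  shows "\<exists>Q'. ensemble n m u (I - {t}) Y x (y - x) P Q'"
proof -
  define d where "d = complex_of_real (u * x)"
  have fin: "finite I" and Y: "\<And>s. s \<in> I \<Longrightarrow> Y s \<in> carrier_mat n m"
    and P: "P \<in> carrier_mat n n" and Q: "Q \<in> carrier_mat m m" "mat_adjoint Q = Q" "Q * Q = Q"
    "mat_trace Q = of_nat y"
    and rows: "\<And>i j. i < n \<Longrightarrow> j < n \<Longrightarrow>
      (\<Sum>t\<in>I. (Y t * mat_adjoint (Y t)) $$ (i, j)) = u * y * P $$ (i, j)"
    and cols: "\<And>i j. i < m \<Longrightarrow> j < m \<Longrightarrow>
      (\<Sum>t\<in>I. (mat_adjoint (Y t) * Y t) $$ (i, j)) = u * x * Q $$ (i, j)"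
    using E by (auto simp: ensemble_def projection_def)
  note Yt = Y[OF t]
  define B where "B = mat_adjoint (Y t) * Y t"
  have B: "B \<in> carrier_mat m m" using Yt by (auto simp: B_def)
  have adjB: "mat_adjoint B = B" using Yt by (simp add: B_def mat_adjoint_mult[of _ m n _ m])
  \<comment> \<open>In the case of equality the right side of \<open>ensemble_deviation\<close> is
    zero.\<close>
  have "Y t * mat_adjoint (Y t) - d \<cdot>\<^sub>m P = 0\<^sub>m n n"
  proof (rule frobenius_eq_0)
    show "frobenius (Y t * mat_adjoint (Y t) - d \<cdot>\<^sub>m P) \<le> 0"
      using ensemble_deviation[OF E t] by (simp add: d_def eq power2_eq_square mult.assoc)
  qed (use P in \<open>simp add: minus_carrier_mat\<close>)
  from mat_diff_eq_zero[OF _ _ this] have YY: "d \<cdot>\<^sub>m P = Y t * mat_adjoint (Y t)"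
    using P Yt by auto
  \<comment> \<open>Together with \<open>QB\<close> and \<open>BQ\<close> this makes
    \<open>inverse d\<close> times \<open>B\<close> a subprojection of \<open>Q\<close>.\<close>
  have BB: "B * B = d \<cdot>\<^sub>m B"
  proof -
    have "B * B = mat_adjoint (Y t) * ((Y t * mat_adjoint (Y t)) * Y t)"
      using Yt unfolding B_def
      by (simp add: assoc_mult_mat[of _ m n _ m _ m] assoc_mult_mat[of _ n m _ n _ m]
          mult_carrier_mat[of _ m n _ m])
    also have "(Y t * mat_adjoint (Y t)) * Y t = d \<cdot>\<^sub>m Y t"
      using P Yt ensemble_support[OF E t] by (simp add: mult_smult_assoc_mat[of _ n n] flip: YY)
    finally show ?thesis using Yt by (simp add: B_def mult_smult_distrib[of _ m n])
  qed
  have QB: "Q * B = B"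
    unfolding B_def using Yt Q ensemble_support[OF ensemble_adjoint[OF E] t]
    by (subst assoc_mult_mat[of Q m m _ n _ m, symmetric]) auto
  then have BQ: "B * Q = B"
    using mat_adjoint_mult[OF Q(1) B] by (simp add: adjB Q)
  have trB: "mat_trace B = d * of_nat x"
    using Yt by (simp add: B_def mat_trace_gram eq d_def power2_eq_square)
  \<comment> \<open>For \<open>x = 0\<close> the convention \<open>inverse 0 = 0\<close> gives
    \<open>Q' = Q\<close>, which is right because \<open>B\<close> is zero.\<close>
  have B0: "B = 0\<^sub>m m m" if "d = 0"
  proof -
    have "frobenius (Y t) \<le> 0" using eq that by (auto simp: d_def power2_eq_square)
    from frobenius_eq_0[OF Yt this] show ?thesis
      using Yt by (simp add: B_def)
  qed
  define Q' where "Q' = Q - inverse d \<cdot>\<^sub>m B"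
  have Q': "Q' \<in> carrier_mat m m" using B Q by (simp add: Q'_def minus_carrier_mat)
  have "projection m (y - x) Q'"
    unfolding projection_def
  proof (intro conjI)
    show "Q' \<in> carrier_mat m m" by fact
    show "mat_adjoint Q' = Q'"
      using B Q by (simp add: Q'_def mat_adjoint_minus[of _ m m] mat_adjoint_smult adjB d_def)
    have QQ': "Q * Q' = Q'"
      using B Q by (simp add: Q'_def mult_minus_distrib_mat[of _ m m _ m] mult_smult_distrib[of _ m m] QB)
    have smult_smult: "inverse d \<cdot>\<^sub>m (d \<cdot>\<^sub>m B) = (inverse d * d) \<cdot>\<^sub>m B"
      by (rule eq_matI) auto
    have "B * Q' = B - (inverse d * d) \<cdot>\<^sub>m B"
      using B Q by (simp add: Q'_def mult_minus_distrib_mat[of _ m m _ m] mult_smult_distrib[of _ m m] BB BQ smult_smult)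
    also have "\<dots> = 0\<^sub>m m m"
      using B B0 by (cases "d = 0") (auto intro!: eq_matI)
    finally have BQ': "B * Q' = 0\<^sub>m m m" .
    have "Q' * Q' = Q * Q' - inverse d \<cdot>\<^sub>m (B * Q')"
      using B Q Q' by (subst (1) Q'_def)
        (simp add: minus_mult_distrib_mat[of _ m m _ _ m] mult_smult_assoc_mat[of _ m m])
    then show "Q' * Q' = Q'" using Q' by (auto simp: QQ' BQ' intro!: eq_matI)
    have "inverse d * (d * of_nat x) = of_nat x" using u by (cases "x = 0") (auto simp: d_def field_simps)
    then have "mat_trace Q' = of_nat y - of_nat x"
      using B Q by (simp add: Q'_def mat_trace_minus[of _ m] mat_trace_smult[of _ m] trB)
    then show "mat_trace Q' = of_nat (y - x)" using xy by (simp add: of_nat_diff)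
  qed
  \<comment> \<open>The removed term is \<open>u * x\<close> times \<open>P\<close>, so the factor
    \<open>u * y\<close> drops to \<open>u * (y - x)\<close>; on the other side the factor
    \<open>u * x\<close> stays and \<open>Q\<close> shrinks to \<open>Q'\<close>.\<close>
  moreover have "(\<Sum>s\<in>I - {t}. (Y s * mat_adjoint (Y s)) $$ (i, j)) = u * (y - x) * P $$ (i, j)"
    if "i < n" "j < n" for i j
  proof -
    have "(Y t * mat_adjoint (Y t)) $$ (i, j) = d * P $$ (i, j)"
      using that P by (simp flip: YY)
    moreover have "(\<Sum>s\<in>I. (Y s * mat_adjoint (Y s)) $$ (i, j))
        = (Y t * mat_adjoint (Y t)) $$ (i, j) + (\<Sum>s\<in>I - {t}. (Y s * mat_adjoint (Y s)) $$ (i, j))"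
      by (rule sum.remove[OF fin t])
    ultimately show ?thesis
      using rows[OF that] xy by (simp add: d_def of_nat_diff algebra_simps)
  qed
  moreover have "(\<Sum>s\<in>I - {t}. (mat_adjoint (Y s) * Y s) $$ (i, j)) = u * x * Q' $$ (i, j)"
    if "i < m" "j < m" for i j
  proof -
    have "(\<Sum>s\<in>I. (mat_adjoint (Y s) * Y s) $$ (i, j))
        = B $$ (i, j) + (\<Sum>s\<in>I - {t}. (mat_adjoint (Y s) * Y s) $$ (i, j))"
      unfolding B_def by (rule sum.remove[OF fin t])
    moreover have "B $$ (i, j) = d * (inverse d * B $$ (i, j))"
      using that B0 by (cases "d = 0") auto
    ultimately show ?thesis
      using cols[OF that] that B Q by (simp add: Q'_def d_def algebra_simps)
  qed
  ultimately show ?thesis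
    using E by (intro exI[of _ Q']) (auto simp: ensemble_def of_nat_diff xy)
qed

text \<open>Each maximal eigenvalue lets \<open>ensemble_split_off\<close> perform one Euclidean
  step; when the first rank is the larger one, it is applied to the adjoint ensemble.\<close>

lemma ensemble_after_squares:
  assumes E: "ensemble n m u {..<N} Y x y P Q" and u: "0 < u"
    and eq: "\<And>s. s < t \<Longrightarrow>
      (if s < N then frobenius (Y s) else 0) = u * (real (square_side x y s))\<^sup>2"
  shows "\<exists>P Q. ensemble n m u {t..<N} Y (fst (sides (x, y) t)) (snd (sides (x, y) t)) P Q"
  using eq
proof (induction t)
  case 0
  have "{0..<N} = {..<N}" by auto
  then show ?case using E by auto
next
  case (Suc t)
  obtain a b where ab: "sides (x, y) t = (a, b)" by fastforce
  from Suc obtain P Q where E': "ensemble n m u {t..<N} Y a b P Q" by (auto simp: ab)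
  have eq: "(if t < N then frobenius (Y t) else 0) = u * (real (min a b))\<^sup>2"
    using Suc.prems[of t] by (simp add: square_side_def ab)
  show ?case
  proof (cases "t < N")
    case True
    have set: "{t..<N} - {t} = {Suc t..<N}" by auto
    show ?thesis
    proof (cases "a \<le> b")
      case True
      then obtain Q' where "ensemble n m u {Suc t..<N} Y a (b - a) P Q'"
        using ensemble_split_off[OF E' _ u True, of t] \<open>t < N\<close> eq by (auto simp: set)
      with True show ?thesis by (auto simp: ab)
    next
      case False
      then obtain P' where "ensemble m n u {Suc t..<N} (\<lambda>t. mat_adjoint (Y t)) b (a - b) Q P'"
        using ensemble_split_off[OF ensemble_adjoint[OF E'] _ u, of t] \<open>t < N\<close> eq
        by (auto simp: set frobenius_adjoint)
      from ensemble_adjoint[OF this] False show ?thesis by (auto simp: ab)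
    qed
  next
    case False
    \<comment> \<open>Beyond \<open>N\<close> the eigenvalue counts as zero, so the hypothesis
      forces a zero side, and \<open>sides\<close> is stationary.\<close>
    with eq u have "min a b = 0" by simp
    then have "sides (x, y) (Suc t) = (a, b)" by (auto simp: ab min_def split: if_splits)
    moreover have "{Suc t..<N} = {t..<N}" using False by auto
    ultimately show ?thesis using E' by auto
  qed
qed

text \<open>Applying \<open>ensemble_weight_le\<close> to the remaining ensemble and to its adjoint
  bounds the weight by both sides, hence by the smaller one.\<close>

lemma ensemble_square_bound:
  assumes E: "ensemble n m u {..<N} Y x y P Q" and u: "0 < u"
    and eq: "\<And>s. s < t \<Longrightarrow>
      (if s < N then frobenius (Y s) else 0) = u * (real (square_side x y s))\<^sup>2"
  shows "(if t < N then frobenius (Y t) else 0) \<le> u * (real (square_side x y t))\<^sup>2"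
proof (cases "t < N")
  case True
  obtain a b where ab: "sides (x, y) t = (a, b)" by fastforce
  obtain P Q where E': "ensemble n m u {t..<N} Y a b P Q"
    using ensemble_after_squares[OF E u, of t] eq by (auto simp: ab)
  have "frobenius (Y t) \<le> u * (real a)\<^sup>2" "frobenius (Y t) \<le> u * (real b)\<^sup>2"
    using ensemble_weight_le[OF E' _ u, of t] ensemble_weight_le[OF ensemble_adjoint[OF E'] _ u, of t] True
    by (auto simp: frobenius_adjoint)
  then show ?thesis using True by (simp add: square_side_def ab min_def)
qed (use u in simp)

section \<open>The state of the square tiling\<close>

lemma sides_le: "fst (sides (n, m) t) \<le> n" "snd (sides (n, m) t) \<le> m"
  using sides_antimono[of 0 t "(n, m)"] by auto

text \<open>Each nonempty square lowers the sum of the two sides by at least one.\<close>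

lemma square_side_eventually_0:
  assumes "n + m \<le> t"
  shows "square_side n m t = 0"
proof -
  have "0 < square_side n m s \<Longrightarrow> fst (sides (n, m) s) + snd (sides (n, m) s) + s \<le> n + m" for s
    by (induction s) (auto simp: square_side_def split: prod.splits if_splits)
  from this[of t] assms show ?thesis
    by (fastforce simp: square_side_def split: prod.splits)
qed

text \<open>Square \<open>t\<close> occupies rows \<open>corner_row n m t, \<dots>\<close> and columns \<open>corner_col n m t, \<dots>\<close> of the \<open>n \<times> m\<close>
  rectangle; the squares are cut off greedily, so what remains is the lower right
  \<open>sides (n, m) t\<close> rectangle.\<close>

definition corner_row :: "nat \<Rightarrow> nat \<Rightarrow> nat \<Rightarrow> nat" where
  "corner_row n m t = n - fst (sides (n, m) t)"

definition corner_col :: "nat \<Rightarrow> nat \<Rightarrow> nat \<Rightarrow> nat" where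
  "corner_col n m t = m - snd (sides (n, m) t)"

text \<open>The last equation says that the offsets of \<open>i\<close> and \<open>j\<close> from
  the corner agree, written without truncated subtraction.\<close>

definition square_diagonal :: "nat \<Rightarrow> nat \<Rightarrow> nat \<Rightarrow> (nat \<times> nat) set" where
  "square_diagonal n m t = {(i, j). corner_row n m t \<le> i \<and> i < corner_row n m t + square_side n m t \<and>
     i + corner_col n m t = j + corner_row n m t}"

text \<open>The first \<open>t\<close> squares cover row \<open>i\<close> up to column
  \<open>corner_col n m t\<close> if the row still meets the remaining rectangle, and entirely
  otherwise.\<close>

lemma row_in_squares:
  assumes "i < n"
  shows "(\<Sum>s<t. if corner_row n m s \<le> i \<and> i < corner_row n m s + square_side n m s
      then square_side n m s else 0) = (if corner_row n m t \<le> i then corner_col n m t else m)"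
proof (induction t)
  case 0
  show ?case by (simp add: corner_row_def corner_col_def)
next
  case (Suc t)
  obtain p q where pq: "sides (n, m) t = (p, q)" by fastforce
  then have "p \<le> n" "q \<le> m" using sides_le[where t = t] by (metis fst_conv snd_conv)+
  with Suc assms show ?case
    by (auto simp: corner_row_def corner_col_def square_side_def pq)
qed

lemma col_in_squares:
  assumes "j < m"
  shows "(\<Sum>s<t. if corner_col n m s \<le> j \<and> j < corner_col n m s + square_side n m s
      then square_side n m s else 0) = (if corner_col n m t \<le> j then corner_row n m t else n)"
proof (induction t)
  case 0
  show ?case by (simp add: corner_row_def corner_col_def)
next
  case (Suc t)
  obtain p q where pq: "sides (n, m) t = (p, q)" by fastforce
  then have "p \<le> n" "q \<le> m" using sides_le[where t = t] by (metis fst_conv snd_conv)+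
  with Suc assms show ?case
    by (auto simp: corner_row_def corner_col_def square_side_def pq)
qed

lemma squares_exhaust: "corner_row n m (n + m) = n \<or> corner_col n m (n + m) = m"
  using square_side_eventually_0[of n m "n + m"]
  by (auto simp: square_side_def corner_row_def corner_col_def split: prod.splits)

lemma corner_le:
  "corner_row n m t + square_side n m t \<le> n" "corner_col n m t + square_side n m t \<le> m"
  using sides_le[where n = n and m = m and t = t]
  by (auto simp: corner_row_def corner_col_def square_side_def split: prod.splits)

text \<open>Cutting off square \<open>s\<close> moves the corner past all its rows or past all its
  columns, and later corners never move back.\<close>

lemma square_diagonal_disjoint:
  assumes "s < t"
  shows "square_diagonal n m s \<inter> square_diagonal n m t = {}"
proof -
  obtain p q where pq: "sides (n, m) s = (p, q)" by fastforce
  then have le: "p \<le> n" "q \<le> m" using sides_le[where t = s] by (metis fst_conv snd_conv)+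
  have "fst (sides (n, m) t) \<le> fst (sides (n, m) (Suc s))" "snd (sides (n, m) t) \<le> snd (sides (n, m) (Suc s))"
    using assms by (auto intro!: sides_antimono simp del: sides.simps)
  then have "corner_row n m (Suc s) \<le> corner_row n m t" "corner_col n m (Suc s) \<le> corner_col n m t"
    by (auto simp: corner_row_def corner_col_def)
  moreover have "corner_row n m (Suc s) = corner_row n m s + square_side n m s
      \<or> corner_col n m (Suc s) = corner_col n m s + square_side n m s"
    using le by (auto simp: corner_row_def corner_col_def square_side_def pq)
  ultimately show ?thesis by (auto simp: square_diagonal_def)
qed

lemma square_diagonal_row_sum:
  "(\<Sum>j<m. if (i, j) \<in> square_diagonal n m t then 1 else 0 :: 'a :: semiring_1)
    = (if corner_row n m t \<le> i \<and> i < corner_row n m t + square_side n m t then 1 else 0)"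
proof -
  have "{j. j < m \<and> (i, j) \<in> square_diagonal n m t}
      = (if corner_row n m t \<le> i \<and> i < corner_row n m t + square_side n m t
         then {i + corner_col n m t - corner_row n m t} else {})"
    using corner_le[of n m t] by (auto simp: square_diagonal_def)
  then show ?thesis
    by (simp add: sum.If_cases Int_def)
qed

lemma square_diagonal_col_sum:
  "(\<Sum>i<n. if (i, j) \<in> square_diagonal n m t then 1 else 0 :: 'a :: semiring_1)
    = (if corner_col n m t \<le> j \<and> j < corner_col n m t + square_side n m t then 1 else 0)"
proof -
  have "{i. i < n \<and> (i, j) \<in> square_diagonal n m t}
      = (if corner_col n m t \<le> j \<and> j < corner_col n m t + square_side n m t
         then {j + corner_row n m t - corner_col n m t} else {})"
    using corner_le[of n m t] by (auto simp: square_diagonal_def)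
  then show ?thesis
    by (simp add: sum.If_cases Int_def)
qed

lemma square_diagonal_sum:
  "(\<Sum>i<n. \<Sum>j<m. if (i, j) \<in> square_diagonal n m t then 1 else 0 :: 'a :: semiring_1)
    = of_nat (square_side n m t)"
proof -
  have "{i. i < n \<and> corner_row n m t \<le> i \<and> i < corner_row n m t + square_side n m t}
      = {corner_row n m t..<corner_row n m t + square_side n m t}"
    using corner_le[of n m t] by auto
  then show ?thesis
    by (simp add: square_diagonal_row_sum sum.If_cases Int_def)
qed

section \<open>The coupling built from the tiling\<close>

lemma sum_lessThan_mult:
  fixes f :: "nat \<Rightarrow> 'a :: comm_monoid_add"
  shows "(\<Sum>k<n * m. f k) = (\<Sum>i<n. \<Sum>j<m. f (i * m + j))"
proof -
  have "sum f {i * m..<i * m + m} = (\<Sum>j<m. f (i * m + j))" for i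
    by (subst sum.atLeastLessThan_shift_0) (simp add: atLeast0LessThan add.commute)
  with sum.nat_group[of f m n] show ?thesis by simp
qed

text \<open>The quadratic form at \<open>v\<close> is the weighted sum of the squared moduli of the
  inner products \<open>z t\<close>.\<close>

lemma positive_semidefinite_ensemble:
  fixes y :: "nat \<Rightarrow> nat \<Rightarrow> complex" and w :: "nat \<Rightarrow> real"
  assumes A: "A \<in> carrier_mat N N" and w: "\<And>t. t \<in> I \<Longrightarrow> 0 \<le> w t"
    and entry: "\<And>k l. k < N \<Longrightarrow> l < N \<Longrightarrow> A $$ (k, l) = (\<Sum>t\<in>I. w t * y t k * cnj (y t l))"
  shows "positive_semidefinite A"
  unfolding positive_semidefinite_def
proof (intro conjI ballI)
  show "square_mat A" using A by auto
  show "mat_adjoint A = A"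
    using A by (intro eq_matI) (auto simp: entry mult_ac intro!: sum.cong)
  fix v :: "complex vec"
  assume "v \<in> carrier_vec (dim_row A)"
  then have v: "v \<in> carrier_vec N" using A by simp
  define z where "z = (\<lambda>t. \<Sum>k<N. cnj (y t k) * v $ k)"
  have "(A *\<^sub>v v) \<bullet>c v = (\<Sum>k<N. \<Sum>l<N. A $$ (k, l) * v $ l * cnj (v $ k))"
    using A v by (auto simp: scalar_prod_def atLeast0LessThan sum_distrib_right intro!: sum.cong)
  also have "\<dots> = (\<Sum>k<N. \<Sum>l<N. \<Sum>t\<in>I. w t * (cnj (y t l) * v $ l * (y t k * cnj (v $ k))))"
    by (auto simp: entry sum_distrib_left sum_distrib_right mult_ac intro!: sum.cong)
  also have "\<dots> = (\<Sum>t\<in>I. \<Sum>k<N. \<Sum>l<N. w t * (cnj (y t l) * v $ l * (y t k * cnj (v $ k))))"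
    by (simp add: sum.swap[of _ I])
  also have "\<dots> = (\<Sum>t\<in>I. w t * (z t * cnj (z t)))"
    by (simp add: z_def sum_distrib_left sum_distrib_right mult_ac)
  also have "\<dots> = complex_of_real (\<Sum>t\<in>I. w t * (cmod (z t))\<^sup>2)"
    by (simp add: complex_norm_square del: of_real_power)
  finally show "0 \<le> (A *\<^sub>v v) \<bullet>c v"
    using w by (auto simp: less_eq_complex_def intro!: sum_nonneg)
qed

definition tiling_vector :: "nat \<Rightarrow> nat \<Rightarrow> nat \<Rightarrow> nat \<Rightarrow> complex" where
  "tiling_vector n m t k = (if (k div m, k mod m) \<in> square_diagonal n m t then 1 else 0)"

text \<open>The vector of a square has squared length equal to the side, so the weight, side over
  \<open>n * m\<close>, produces the relative area as eigenvalue. The entries are real, hence no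
  conjugate; the range \<open>n + m\<close> covers all nonempty squares.\<close>

definition tiling_state :: "nat \<Rightarrow> nat \<Rightarrow> complex mat" where
  "tiling_state n m = mat (n * m) (n * m) (\<lambda>(k, l). \<Sum>t<n + m.
     of_nat (square_side n m t) / of_nat (n * m) * tiling_vector n m t k * tiling_vector n m t l)"

context
  fixes n m :: nat
  assumes pos: "0 < n" "0 < m"
begin

lemma tiling_vector_index: "j < m \<Longrightarrow>
  tiling_vector n m t (i * m + j) = (if (i, j) \<in> square_diagonal n m t then 1 else 0)"
  by (simp add: tiling_vector_def)

lemma index_less: "i < n \<Longrightarrow> j < m \<Longrightarrow> i * m + j < n * m"
  using mult_le_mono1[of "Suc i" n m] by simp

lemma ptrace_B_tiling_state: "ptrace_B n m (tiling_state n m) = max_mixed n"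
proof (rule eq_matI)
  fix i i' assume "i < dim_row (max_mixed n)" "i' < dim_col (max_mixed n)"
  then have i: "i < n" "i' < n" by (auto simp: max_mixed_def)
  let ?c = "\<lambda>t. of_nat (square_side n m t) / of_nat (n * m) :: complex"
  have "ptrace_B n m (tiling_state n m) $$ (i, i')
      = (\<Sum>j<m. \<Sum>t<n + m. ?c t * tiling_vector n m t (i * m + j) * tiling_vector n m t (i' * m + j))"
    using i by (simp add: ptrace_B_def tiling_state_def index_less)
  \<comment> \<open>A diagonal meets column \<open>j\<close> in at most one row, so only
    \<open>i = i'\<close> contributes.\<close>
  also have "\<dots> = (\<Sum>j<m. \<Sum>t<n + m. if i = i' then ?c t * (if (i, j) \<in> square_diagonal n m t then 1 else 0) else 0)"
    by (intro sum.cong refl) (auto simp: tiling_vector_index square_diagonal_def)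
  also have "\<dots> = (if i = i' then (\<Sum>t<n + m. ?c t * (\<Sum>j<m. if (i, j) \<in> square_diagonal n m t then 1 else 0)) else 0)"
    by (simp add: sum.swap[of _ "{..<n + m}"] sum_distrib_left)
  also have "\<dots> = (if i = i' then of_nat (\<Sum>t<n + m. if corner_row n m t \<le> i \<and>
      i < corner_row n m t + square_side n m t then square_side n m t else 0) / of_nat (n * m) else 0)"
    unfolding square_diagonal_row_sum of_nat_sum sum_divide_distrib
    by (auto intro!: sum.cong)
  also have "\<dots> = (if i = i' then of_nat m / of_nat (n * m) else 0)"
  proof -
    \<comment> \<open>After \<open>n + m\<close> squares no row or no column remains; either way row
      \<open>i\<close> is covered to its full width \<open>m\<close>.\<close>
    have "(\<Sum>t<n + m. if corner_row n m t \<le> i \<and> i < corner_row n m t + square_side n m t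
        then square_side n m t else 0) = m"
      using row_in_squares[OF i(1), where m = m and t = "n + m"] squares_exhaust[of n m] i by auto
    then show ?thesis by (simp only:)
  qed
  finally show "ptrace_B n m (tiling_state n m) $$ (i, i') = max_mixed n $$ (i, i')"
    using i pos by (simp add: max_mixed_def)
qed (auto simp: ptrace_B_def max_mixed_def)

lemma ptrace_A_tiling_state: "ptrace_A n m (tiling_state n m) = max_mixed m"
proof (rule eq_matI)
  fix j j' assume "j < dim_row (max_mixed m)" "j' < dim_col (max_mixed m)"
  then have j: "j < m" "j' < m" by (auto simp: max_mixed_def)
  let ?c = "\<lambda>t. of_nat (square_side n m t) / of_nat (n * m) :: complex"
  have "ptrace_A n m (tiling_state n m) $$ (j, j')
      = (\<Sum>i<n. \<Sum>t<n + m. ?c t * tiling_vector n m t (i * m + j) * tiling_vector n m t (i * m + j'))"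
    using j by (simp add: ptrace_A_def tiling_state_def index_less)
  also have "\<dots> = (\<Sum>i<n. \<Sum>t<n + m. if j = j' then ?c t * (if (i, j) \<in> square_diagonal n m t then 1 else 0) else 0)"
    using j by (intro sum.cong refl) (auto simp: tiling_vector_index square_diagonal_def)
  also have "\<dots> = (if j = j' then (\<Sum>t<n + m. ?c t * (\<Sum>i<n. if (i, j) \<in> square_diagonal n m t then 1 else 0)) else 0)"
    by (simp add: sum.swap[of _ "{..<n + m}"] sum_distrib_left)
  also have "\<dots> = (if j = j' then of_nat (\<Sum>t<n + m. if corner_col n m t \<le> j \<and>
      j < corner_col n m t + square_side n m t then square_side n m t else 0) / of_nat (n * m) else 0)"
    unfolding square_diagonal_col_sum of_nat_sum sum_divide_distrib
    by (auto intro!: sum.cong)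
  also have "\<dots> = (if j = j' then of_nat n / of_nat (n * m) else 0)"
  proof -
    have "(\<Sum>t<n + m. if corner_col n m t \<le> j \<and> j < corner_col n m t + square_side n m t
        then square_side n m t else 0) = n"
      using col_in_squares[OF j(1), where n = n and t = "n + m"] squares_exhaust[of n m] j by auto
    then show ?thesis by (simp only:)
  qed
  finally show "ptrace_A n m (tiling_state n m) $$ (j, j') = max_mixed m $$ (j, j')"
    using j pos by (simp add: max_mixed_def)
qed (auto simp: ptrace_A_def max_mixed_def)

lemma tiling_state_coupling: "tiling_state n m \<in> couplings (max_mixed n) (max_mixed m)"
proof -
  have "positive_semidefinite (tiling_state n m)"
    by (rule positive_semidefinite_ensemble[where I = "{..<n + m}" and N = "n * m"
          and w = "\<lambda>t. square_side n m t / (n * m)" and y = "tiling_vector n m"])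
      (auto simp: tiling_state_def tiling_vector_def intro!: sum.cong)
  moreover have "mat_trace (tiling_state n m) = (\<Sum>i<n. ptrace_B n m (tiling_state n m) $$ (i, i))"
    by (simp add: mat_trace_def tiling_state_def ptrace_B_def sum_lessThan_mult index_less cong: sum.cong_simp)
  moreover have "\<dots> = 1"
    using pos by (simp add: ptrace_B_tiling_state) (simp add: max_mixed_def)
  ultimately show ?thesis
    using ptrace_A_tiling_state ptrace_B_tiling_state
    by (simp add: couplings_def density_operators_def) (simp add: max_mixed_def tiling_state_def)
qed

text \<open>The state factors as \<open>V * W\<close>, while \<open>W * V\<close> is diagonal
  because disjoint diagonals give orthogonal vectors. \<open>char_poly_mult_swap\<close> transfers
  the eigenvalues up to zeros, and they are already in decreasing order.\<close>

lemma Spec_tiling_state: "Spec (tiling_state n m) = (\<lambda>t. (real (square_side n m t))\<^sup>2 / real (n * m))"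
proof -
  let ?N = "n * m" and ?r = "n + m"
  define V where "V = mat ?N ?r (\<lambda>(k, t). tiling_vector n m t k)"
  define W where "W = mat ?r ?N (\<lambda>(t, k). of_nat (square_side n m t) / of_nat (n * m) * tiling_vector n m t k)"
  define c where "c = (\<lambda>t. (real (square_side n m t))\<^sup>2 / real (n * m))"
  have V: "V \<in> carrier_mat ?N ?r" and W: "W \<in> carrier_mat ?r ?N" by (auto simp: V_def W_def)
  have VW: "tiling_state n m = V * W"
    by (rule eq_matI)
      (auto simp: tiling_state_def V_def W_def scalar_prod_def atLeast0LessThan mult_ac intro!: sum.cong)
  have WV: "W * V = mat_diag ?r (\<lambda>t. complex_of_real (c t))"
  proof (rule eq_matI)
    fix t t' assume "t < dim_row (mat_diag ?r (\<lambda>t. complex_of_real (c t)))"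
      "t' < dim_col (mat_diag ?r (\<lambda>t. complex_of_real (c t)))"
    then have t: "t < ?r" "t' < ?r" by (auto simp: mat_diag_def)
    let ?c = "of_nat (square_side n m t) / of_nat (n * m) :: complex"
    have "(W * V) $$ (t, t') = ?c * (\<Sum>k<?N. tiling_vector n m t k * tiling_vector n m t' k)"
      using t by (simp add: V_def W_def scalar_prod_def atLeast0LessThan sum_distrib_left mult_ac)
    also have "\<dots> = ?c * (\<Sum>i<n. \<Sum>j<m. if t = t' \<and> (i, j) \<in> square_diagonal n m t then 1 else 0)"
    proof -
      have "square_diagonal n m t \<inter> square_diagonal n m t' = {}" if "t \<noteq> t'"
        using square_diagonal_disjoint[of t t'] square_diagonal_disjoint[of t' t] that
        by (cases t t' rule: linorder_cases) auto
      then show ?thesis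
        unfolding sum_lessThan_mult
        by (intro arg_cong2[of _ _ _ _ "(*)"] sum.cong refl) (auto simp: tiling_vector_index)
    qed
    also have "\<dots> = (if t = t' then complex_of_real (c t) else 0)"
      by (simp add: square_diagonal_sum c_def power2_eq_square)
    finally show "(W * V) $$ (t, t') = mat_diag ?r (\<lambda>t. complex_of_real (c t)) $$ (t, t')"
      using t by (simp add: mat_diag_def)
  qed (use V W in \<open>auto simp: mat_diag_def\<close>)
  have c_mono: "c t \<le> c s" if "s \<le> t" for s t
    using square_side_antimono[of n m] that pos
    by (auto simp: c_def antimono_def intro!: divide_right_mono power_mono)
  have "Spec (tiling_state n m) = nth_default 0 (map c [0..<?r])"
  proof (rule Spec_eqI[of ?r _ ?N])
    show "[:0, 1:] ^ ?r * char_poly (tiling_state n m)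
        = [:0, 1:] ^ ?N * (\<Prod>e\<leftarrow>map c [0..<?r]. [:- complex_of_real e, 1:])"
      using char_poly_mult_swap[OF V W] by (simp add: VW WV char_poly_mat_diag comp_def)
    show "char_poly (tiling_state n m) \<noteq> 0"
      by (rule char_poly_nonzero[of _ ?N]) (simp add: tiling_state_def)
    show "sorted (rev (map c [0..<?r]))"
      by (auto simp: sorted_iff_nth_mono rev_nth intro!: c_mono)
  qed (auto simp: c_def)
  also have "\<dots> = c"
    using square_side_eventually_0[of n m]
    by (auto simp: fun_eq_iff nth_default_def c_def)
  finally show ?thesis by (simp add: c_def)
qed

end

section \<open>Lexicographic maximality\<close>

text \<open>The scaled eigenvectors are reshaped into matrices. With \<open>u = 1 / (n * m)\<close>
  the factors \<open>u * m\<close> and \<open>u * n\<close> are \<open>1 / n\<close> and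
  \<open>1 / m\<close>, so both marginals are multiples of identities, which are projections of full
  rank.\<close>

lemma coupling_ensemble:
  assumes pos: "0 < n" "0 < m" and \<rho>: "\<rho> \<in> couplings (max_mixed n) (max_mixed m)"
  obtains Y where "ensemble n m (1 / real (n * m)) {..<n * m} Y n m (1\<^sub>m n) (1\<^sub>m m)"
    and "\<And>t. Spec \<rho> t = (if t < n * m then frobenius (Y t) else 0)"
proof -
  have carr: "\<rho> \<in> carrier_mat (n * m) (n * m)" and psd: "positive_semidefinite \<rho>"
    and trB: "ptrace_B n m \<rho> = max_mixed n" and trA: "ptrace_A n m \<rho> = max_mixed m"
    using \<rho> by (auto simp: couplings_def density_operators_def max_mixed_def)
  obtain y where y: "\<And>k l. k < n * m \<Longrightarrow> l < n * m \<Longrightarrow> \<rho> $$ (k, l) = (\<Sum>t<n * m. y t k * cnj (y t l))"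
    and Spec: "\<And>t. t < n * m \<Longrightarrow> (\<Sum>k<n * m. (cmod (y t k))\<^sup>2) = Spec \<rho> t"
    "\<And>t. n * m \<le> t \<Longrightarrow> Spec \<rho> t = 0"
    using spectral_decomposition[OF psd carr] by blast
  define Y where "Y = (\<lambda>t. mat n m (\<lambda>(i, j). y t (i * m + j)))"
  have Y: "Y t \<in> carrier_mat n m" for t by (simp add: Y_def)
  have rows: "(\<Sum>t<n * m. (Y t * mat_adjoint (Y t)) $$ (i, i')) = 1 / of_nat n * 1\<^sub>m n $$ (i, i')"
    if "i < n" "i' < n" for i i'
  proof -
    have "(\<Sum>t<n * m. (Y t * mat_adjoint (Y t)) $$ (i, i'))
        = (\<Sum>t<n * m. \<Sum>j<m. y t (i * m + j) * cnj (y t (i' * m + j)))"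
      using that by (simp add: Y_def scalar_prod_def atLeast0LessThan)
    also have "\<dots> = (\<Sum>j<m. \<rho> $$ (i * m + j, i' * m + j))"
      using that by (simp add: sum.swap[of _ "{..<m}"] y index_less[OF pos] cong: sum.cong_simp)
    also have "\<dots> = ptrace_B n m \<rho> $$ (i, i')" using that by (simp add: ptrace_B_def)
    finally show ?thesis using that by (simp add: trB) (simp add: max_mixed_def)
  qed
  have cols: "(\<Sum>t<n * m. (mat_adjoint (Y t) * Y t) $$ (j, j')) = 1 / of_nat m * 1\<^sub>m m $$ (j, j')"
    if "j < m" "j' < m" for j j'
  proof -
    have "(\<Sum>t<n * m. (mat_adjoint (Y t) * Y t) $$ (j, j'))
        = (\<Sum>t<n * m. \<Sum>i<n. y t (i * m + j') * cnj (y t (i * m + j)))"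
      using that by (simp add: Y_def scalar_prod_def atLeast0LessThan mult.commute)
    also have "\<dots> = (\<Sum>i<n. \<rho> $$ (i * m + j', i * m + j))"
      using that by (simp add: sum.swap[of _ "{..<n}"] y index_less[OF pos] cong: sum.cong_simp)
    \<comment> \<open>The column sums give the transposed marginal; the maximally mixed state is
      symmetric.\<close>
    also have "\<dots> = ptrace_A n m \<rho> $$ (j', j)" using that by (simp add: ptrace_A_def)
    finally show ?thesis using that by (simp add: trA) (auto simp: max_mixed_def)
  qed
  have one: "projection d d (1\<^sub>m d)" for d by (simp add: projection_def mat_trace_def)
  show thesis
  proof (rule that)
    show "ensemble n m (1 / real (n * m)) {..<n * m} Y n m (1\<^sub>m n) (1\<^sub>m m)"
      using rows cols Y one pos by (simp add: ensemble_def)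
    show "Spec \<rho> t = (if t < n * m then frobenius (Y t) else 0)" for t
      using Spec(1)[of t] Spec(2)[of t] by (simp add: frobenius_def Y_def sum_lessThan_mult)
  qed
qed

text \<open>At the first index of disagreement all earlier eigenvalues are maximal, so
  \<open>ensemble_square_bound\<close> applies and the inequality is strict.\<close>

lemma coupling_spectrum_lex_le:
  assumes pos: "0 < n" "0 < m" and \<rho>: "\<rho> \<in> couplings (max_mixed n) (max_mixed m)"
  shows "lex_le (Spec \<rho>) (\<lambda>t. (real (square_side n m t))\<^sup>2 / real (n * m))"
proof (cases "\<exists>t. Spec \<rho> t \<noteq> (real (square_side n m t))\<^sup>2 / real (n * m)")
  case True
  obtain Y where Y: "ensemble n m (1 / real (n * m)) {..<n * m} Y n m (1\<^sub>m n) (1\<^sub>m m)"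
    and Spec: "\<And>t. Spec \<rho> t = (if t < n * m then frobenius (Y t) else 0)"
    using coupling_ensemble[OF assms] by blast
  define t where "t = (LEAST t. Spec \<rho> t \<noteq> (real (square_side n m t))\<^sup>2 / real (n * m))"
  have ne: "Spec \<rho> t \<noteq> (real (square_side n m t))\<^sup>2 / real (n * m)"
    unfolding t_def by (rule LeastI_ex[OF True])
  have eq: "Spec \<rho> s = (real (square_side n m s))\<^sup>2 / real (n * m)" if "s < t" for s
    using not_less_Least[of s] that unfolding t_def by blast
  have "Spec \<rho> t \<le> 1 / real (n * m) * (real (square_side n m t))\<^sup>2"
    unfolding Spec
  proof (rule ensemble_square_bound[OF Y])
    show "(if s < n * m then frobenius (Y s) else 0) = 1 / real (n * m) * (real (square_side n m s))\<^sup>2"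
      if "s < t" for s
      using eq[OF that] by (simp add: Spec)
  qed (use pos in simp)
  with ne have "Spec \<rho> t < (real (square_side n m t))\<^sup>2 / real (n * m)" by simp
  with eq show ?thesis unfolding lex_le_def less_fun_def by blast
next
  case False
  then show ?thesis by (auto simp: lex_le_def)
qed

theorem theorem3p6:
  fixes n m k a b :: nat and \<nu> :: "nat \<Rightarrow> nat"
  assumes "0 < n" and "n \<le> m"
    and "k = lcm n m" and "a = k div n" and "b = k div m"
    and "strip_type (rect_partition a n) (rect_partition b m) \<nu>"
  shows "is_lex_max (\<lambda>i. real (\<nu> i) / real k) (coupling_spectra (max_mixed n) (max_mixed m))"
proof -
  have pos: "0 < n" "0 < m" using assms(1,2) by auto
  \<comment> \<open>Dividing out the gcd gives \<open>k = g * p * q\<close>, \<open>a = q\<close>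
    and \<open>b = p\<close>, the form of the rectangles in
    \<open>strip_type_rectangles\<close>.\<close>
  define g where "g = gcd n m"
  have "0 < g" using pos by (simp add: g_def)
  obtain p q where p: "n = g * p" and q: "m = g * q"
    unfolding g_def by (meson dvdE gcd_dvd1 gcd_dvd2)
  have "g * k = n * m" using prod_gcd_lcm_nat[of n m] by (simp add: assms(3) g_def)
  then have "g * k = g * (g * p * q)" by (simp add: p q mult_ac)
  with \<open>0 < g\<close> have k: "k = g * p * q" by (simp add: mult.assoc mult.left_commute)
  have a: "a = q" and b: "b = p"
    using pos unfolding assms(4,5) k by (simp_all add: p q)
  have "\<nu> t = g * (square_side p q t)\<^sup>2" for t
    using strip_type_rectangles assms(6) unfolding a b p q by blast
  moreover have "square_side n m t = g * square_side p q t" for t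
    by (simp add: p q square_side_mult)
  \<comment> \<open>Both quotients equal
    \<open>(square_side p q t)\<^sup>2 / (p * q)\<close>.\<close>
  ultimately have \<nu>: "real (\<nu> t) / real k = (real (square_side n m t))\<^sup>2 / real (n * m)" for t
    using \<open>0 < g\<close> by (simp add: k p q power2_eq_square)
  have "Spec (tiling_state n m) \<in> coupling_spectra (max_mixed n) (max_mixed m)"
    unfolding coupling_spectra_def by (rule imageI[OF tiling_state_coupling[OF pos]])
  then show ?thesis
    using coupling_spectrum_lex_le[OF pos]
    by (auto simp: is_lex_max_def \<nu> Spec_tiling_state[OF pos] coupling_spectra_def)
qed

end
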